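(* Let $y_0,y_1,\dots,y_T$ be given observations and let $\mathbb{P}_N(E)=\sum_{i=1}^N w_0^{(i)}\,\delta_{z_{0:T}^{(i)}}(E)$ be the discrete distribution over particles, with $\{(z_{0:T}^{(i)},w_0^{(i)})\}_{i=1}^N$ returned by the SMC procedure described in the context with $N$ particles. Assume for all $t$: (a) The likelihood functions $p_\theta(y_t\mid z_t)=\mathcal{N}(y_t\mid\mathcal{A}(\mathcal{D}(z_t)),\tau^2I)$, the ratios $\bar p_\theta(y_0\mid z_t)/\bar p_\theta(y_0\mid z_{t+1})$, and $\bar p_\theta(y_0\mid z_T)$, are all positive and bounded. (b) $\log\bar p_\theta(y_0\mid z_t)$ is continuous and has bounded gradients in $z_t$. (c) $\log q_\theta(y_t\mid z_{t+1})$ is continuous and has bounded gradients in $\mu_\theta(z_{t+1},t+1)$. (d) The proposal variance is larger than the prior diffusion model variance, namely $\tilde\sigma_t^2>\sigma_t^2$. Then $\mathbb{P}_N$ converges setwise to $p_\theta(z_{0:T}\mid y_{0:T})$ with probability one, that is, for every (measurable) set $E$, $$\lim_{N\to\infty}\mathbb{P}_N(E)=\int_E p_\theta(z_{0:T}\mid y_{0:T})\,dz_{0:T}.$$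
   Context: Notation. $\mathcal{N}(x\mid\mu,\Sigma)$ is the Gaussian density at $x$ with mean $\mu$ and covariance $\Sigma$; $I$ is an identity matrix; $z_{s:T}=(z_s,\dots,z_T)$; $\delta_z$ is the Dirac measure at $z$. $\mathcal{D}$ (a decoder, from latent space to image space), $\mathcal{A}$ (a corruption operator, from image space to observation space) and $\epsilon_\theta(\cdot,t)$ (a noise-prediction network, from latent space to itself) are given maps; $\tau$ is a known standard deviation. The diffusion variance schedule is $\alpha_{1:T}$, $\beta_t=1-\alpha_t$, $\bar\alpha_t=\prod_{j=1}^t\alpha_j$. The standard deviation of the prior diffusion model is $\sigma_t=\eta\sqrt{\beta_t\,(1-\bar\alpha_{t-1})/(1-\bar\alpha_t)}$ with $\eta$ a hyperparameter; $\tilde\sigma_t$ is the standard deviation of the proposal. Prior diffusion model. Put $\bar z_0(z_t)=\frac{1}{\sqrt{\bar\alpha_t}}\bigl(z_t-\sqrt{1-\bar\alpha_t}\,\epsilon_\theta(z_t,t)\bigr)$, and let $\mu_\theta(z_t,t)=\sqrt{\bar\alpha_{t-1}}\,\bar z_0(z_t)+\sqrt{1-\bar\alpha_{t-1}-\sigma_t^2}\;\epsilon_\theta(z_t,t)$ for $t>1$ and $\mu_\theta(z_1,1)=\bar z_0(z_1)$. The prior on $z_{0:T}$ is the Markov chain with $p_\theta(z_T)=\mathcal{N}(z_T\mid0,I)$ and $p_\theta(z_t\mid z_{t+1})=\mathcal{N}(z_t\mid\mu_\theta(z_{t+1},t+1),\sigma_{t+1}^2I)$ for $t<T$. Observation model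 and posterior. Given $z_{0:T}$, the $y_t$ are independent with $p_\theta(y_t\mid z_t)=\mathcal{N}(y_t\mid\mathcal{A}(\mathcal{D}(z_t)),\tau^2I)$, $0\le t\le T$. The posterior is $$p_\theta(z_{0:T}\mid y_{0:T})\propto p_\theta(z_T)\prod_{t=0}^{T-1}p_\theta(z_t\mid z_{t+1})\prod_{t=0}^{T}p_\theta(y_t\mid z_t).$$ Auxiliary densities. $\bar p_\theta(y_0\mid z_t)=\mathcal{N}\bigl(y_0\mid\mathcal{A}(\mathcal{D}(\bar z_0(z_t))),(1-\bar\alpha_t)I\bigr)$ and $q_\theta(y_t\mid z_{t+1})=\mathcal{N}\bigl(y_t\mid\mathcal{A}(\mathcal{D}(\mu_\theta(z_{t+1},t+1))),\tau^2I\bigr)$. Proposals. $\pi_T(z_T)=\mathcal{N}(z_T\mid0,I)$, and for $t<T$, $\pi_t(z_t\mid z_{t+1})=\mathcal{N}(z_t\mid m_t,\tilde\sigma_{t+1}^2I)$ with $$m_t=\mu_\theta(z_{t+1},t+1)-\bigl(\gamma_t\nabla_{z_{t+1}}\log\bar p_\theta(y_0\mid z_{t+1})+\lambda_t\nabla_{\mu_\theta(z_{t+1},t+1)}\log q_\theta(y_t\mid z_{t+1})\bigr),$$ where $\gamma_t,\lambda_t$ are finite scaling coefficients and the last gradient is taken with respect to $\mu_\theta(z_{t+1},t+1)$, as an argument of $\mu\mapsto\log\mathcal{N}(y_t\mid\mathcal{A}(\mathcal{D}(\mu)),\tau^2I)$. Unnormalized weighting functions. $$\tilde w_T(z_T)=p_\theta(y_T\mid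 z_T)\,\bar p_\theta(y_0\mid z_T),$$ $$\tilde w_t(z_t,z_{t+1})=\frac{p_\theta(y_t\mid z_t)\,\bar p_\theta(y_0\mid z_t)\,p_\theta(z_t\mid z_{t+1})}{\bar p_\theta(y_0\mid z_{t+1})\,\pi_t(z_t\mid z_{t+1})}\quad(0<t<T),$$ $$\tilde w_0(z_0,z_1)=\frac{p_\theta(y_0\mid z_0)\,p_\theta(z_0\mid z_1)}{\bar p_\theta(y_0\mid z_1)\,\pi_0(z_0\mid z_1)}.$$ SMC procedure with $N$ particles (sequential importance sampling with multinomial resampling at every step). Draw $z_T^{(1)},\dots,z_T^{(N)}$ independently from $\pi_T$ and set weights $w_T^{(i)}\propto\tilde w_T(z_T^{(i)})$, normalized to sum to one over $i$. For $t=T-1,\dots,0$: (1) resample the $N$ current paths $z_{t+1:T}^{(i)}$ multinomially with probabilities $w_{t+1}^{(i)}$; (2) for each $i$ draw $z_t^{(i)}\sim\pi_t(\cdot\mid z_{t+1}^{(i)})$ and append it to the path; (3) set $w_t^{(i)}\propto\tilde w_t(z_t^{(i)},z_{t+1}^{(i)})$, normalized to sum to one over $i$. Return $\{(z_{0:T}^{(i)},w_0^{(i)})\}_{i=1}^N$.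
   Formalization: The stated formula gives σ_1 = 0, so p(z_0|z_1) is no density; here σ_1 is a free positive parameter. In (a) at t = 0, the undefined p̄(y_0|z_0) is read as p(y_0|z_0). The probability-one convergence is for each fixed E. D, A and ε are taken measurable, η > 0, 0 < α_t < 1, T ≥ 1. *)

theory Defs
  imports "HOL-Probability.Probability"
begin

section \<open>Isotropic Gaussians and gradients\<close>

definition gauss :: "'a::euclidean_space \<Rightarrow> real \<Rightarrow> 'a \<Rightarrow> real" where
  "gauss m s x = (\<Prod>b\<in>Basis. normal_density (m \<bullet> b) s (x \<bullet> b))"
  \<comment> \<open>the density of mean m and covariance $s^2 I$ at x; the parameter s is the standard deviation\<close>

definition grad :: "('a::euclidean_space \<Rightarrow> real) \<Rightarrow> 'a \<Rightarrow> 'a" where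
  "grad f x = (THE g. GDERIV f x :> g)"

definition bounded_gradients :: "('a::euclidean_space \<Rightarrow> real) \<Rightarrow> bool" where
  "bounded_gradients f \<longleftrightarrow> (\<forall>x. f differentiable (at x)) \<and> bounded (range (grad f))"

definition positive_bounded :: "('a \<Rightarrow> real) \<Rightarrow> bool" where
  "positive_bounded f \<longleftrightarrow> (\<forall>x. 0 < f x) \<and> bounded (range f)"


section \<open>The prior diffusion model, the observations and the proposals\<close>

text \<open>
  The types \<open>'z\<close>, \<open>'x\<close>, \<open>'y\<close> are the latent, image and observation spaces. The formula
  for the prior standard deviation degenerates at time 1: it contains the factor
  $1 - \bar\alpha_0$, where $\bar\alpha_0$ is an empty product, whereas the transition from
  time 1 to time 0 is used as a density. As in DDIM, the last standard deviation is
  therefore a free parameter \<open>sigma1\<close>, which has to be positive.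
\<close>

record ('z, 'x, 'y) diffusion =
  horizon :: nat                      \<comment> \<open>$T$\<close>
  alpha :: "nat \<Rightarrow> real"
  eta :: real
  sigma1 :: real                      \<comment> \<open>$\sigma_1$\<close>
  proposal_sd :: "nat \<Rightarrow> real"            \<comment> \<open>$\tilde\sigma_t$\<close>
  gam :: "nat \<Rightarrow> real"
  lam :: "nat \<Rightarrow> real"
  tau :: real
  dec :: "'z \<Rightarrow> 'x"                   \<comment> \<open>decoder $\mathcal{D}$\<close>
  corr :: "'x \<Rightarrow> 'y"                  \<comment> \<open>corruption operator $\mathcal{A}$\<close>
  eps :: "'z \<Rightarrow> nat \<Rightarrow> 'z"            \<comment> \<open>noise prediction $\epsilon_\theta$\<close>
  obs :: "nat \<Rightarrow> 'y"                  \<comment> \<open>$y_t$\<close>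

definition beta :: "('z, 'x, 'y) diffusion \<Rightarrow> nat \<Rightarrow> real" where
  "beta S t = 1 - alpha S t"

definition abar :: "('z, 'x, 'y) diffusion \<Rightarrow> nat \<Rightarrow> real" where
  "abar S t = (\<Prod>j=1..t. alpha S j)"

definition prior_sd :: "('z, 'x, 'y) diffusion \<Rightarrow> nat \<Rightarrow> real" where
  "prior_sd S t = (if t = 1 then sigma1 S
     else eta S * sqrt (beta S t * (1 - abar S (t - 1)) / (1 - abar S t)))"

definition zbar :: "('z::euclidean_space, 'x, 'y) diffusion \<Rightarrow> nat \<Rightarrow> 'z \<Rightarrow> 'z" where
  "zbar S t z = (1 / sqrt (abar S t)) *\<^sub>R (z - sqrt (1 - abar S t) *\<^sub>R eps S z t)"

definition mu :: "('z::euclidean_space, 'x, 'y) diffusion \<Rightarrow> nat \<Rightarrow> 'z \<Rightarrow> 'z" where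
  "mu S t z = (if t = 1 then zbar S 1 z
     else sqrt (abar S (t - 1)) *\<^sub>R zbar S t z
          + sqrt (1 - abar S (t - 1) - (prior_sd S t)\<^sup>2) *\<^sub>R eps S z t)"

text \<open>In \<open>transition S t z' z\<close> and in the proposals below, \<open>z'\<close> is the state at time $t+1$
  and \<open>z\<close> the state at time $t$.\<close>

definition transition :: "('z::euclidean_space, 'x, 'y) diffusion \<Rightarrow> nat \<Rightarrow> 'z \<Rightarrow> 'z \<Rightarrow> real" where
  "transition S t z' z = gauss (mu S (t + 1) z') (prior_sd S (t + 1)) z"

definition lik :: "('z, 'x, 'y::euclidean_space) diffusion \<Rightarrow> nat \<Rightarrow> 'z \<Rightarrow> real" where
  "lik S t z = gauss (corr S (dec S z)) (tau S) (obs S t)"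

text \<open>The Gaussian formula for $\bar p_\theta(y_0 \mid z_t)$ has variance 0 at $t = 0$, where
  the estimate of $z_0$ is $z_0$ itself. There the quantity it approximates,
  $p_\theta(y_0 \mid z_0)$, is taken instead, so that the ratio of the values at times 0 and 1
  is the corresponding factor of the last weight.\<close>

definition pbar :: "('z::euclidean_space, 'x, 'y::euclidean_space) diffusion \<Rightarrow> nat \<Rightarrow> 'z \<Rightarrow> real" where
  "pbar S t z = (if t = 0 then lik S 0 z
     else gauss (corr S (dec S (zbar S t z))) (sqrt (1 - abar S t)) (obs S 0))"

text \<open>$q_\theta(y_t \mid z_{t+1})$ as a function of its argument $m = \mu_\theta(z_{t+1}, t+1)$.\<close>

definition q_of_mean :: "('z, 'x, 'y::euclidean_space) diffusion \<Rightarrow> nat \<Rightarrow> 'z \<Rightarrow> real" where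
  "q_of_mean S t m = gauss (corr S (dec S m)) (tau S) (obs S t)"

definition proposal_mean ::
    "('z::euclidean_space, 'x, 'y::euclidean_space) diffusion \<Rightarrow> nat \<Rightarrow> 'z \<Rightarrow> 'z" where
  "proposal_mean S t z' = mu S (t + 1) z' -
     (gam S t *\<^sub>R grad (\<lambda>z. ln (pbar S (t + 1) z)) z' +
      lam S t *\<^sub>R grad (\<lambda>m. ln (q_of_mean S t m)) (mu S (t + 1) z'))"

definition proposal ::
    "('z::euclidean_space, 'x, 'y::euclidean_space) diffusion \<Rightarrow> nat \<Rightarrow> 'z \<Rightarrow> 'z \<Rightarrow> real" where
  "proposal S t z' z = gauss (proposal_mean S t z') (proposal_sd S (t + 1)) z"


section \<open>The posterior\<close>

text \<open>A path $z_{t:T}$ is a function on \<open>{t..T}\<close>, extended by \<open>undefined\<close>.\<close>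

definition path_space :: "('z::euclidean_space, 'x, 'y) diffusion \<Rightarrow> nat \<Rightarrow> (nat \<Rightarrow> 'z) measure" where
  "path_space S t = (\<Pi>\<^sub>M s\<in>{t..horizon S}. borel)"

definition path_lebesgue :: "('z::euclidean_space, 'x, 'y) diffusion \<Rightarrow> (nat \<Rightarrow> 'z) measure" where
  "path_lebesgue S = (\<Pi>\<^sub>M s\<in>{0..horizon S}. lborel)"

definition joint ::
    "('z::euclidean_space, 'x, 'y::euclidean_space) diffusion \<Rightarrow> (nat \<Rightarrow> 'z) \<Rightarrow> real" where
  "joint S z = gauss 0 1 (z (horizon S))
     * (\<Prod>t<horizon S. transition S t (z (t + 1)) (z t))
     * (\<Prod>t\<le>horizon S. lik S t (z t))"

definition posterior ::
    "('z::euclidean_space, 'x, 'y::euclidean_space) diffusion \<Rightarrow> (nat \<Rightarrow> 'z) \<Rightarrow> real" where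
  "posterior S z = joint S z / (LINT z'|path_lebesgue S. joint S z')"


section \<open>The SMC procedure\<close>

definition weight ::
    "('z::euclidean_space, 'x, 'y::euclidean_space) diffusion \<Rightarrow> nat \<Rightarrow> (nat \<Rightarrow> 'z) \<Rightarrow> real" where
  "weight S t z =
     (if t = horizon S then lik S t (z t) * pbar S t (z t)
      else if t = 0 then
        lik S 0 (z 0) * transition S 0 (z 1) (z 0) / (pbar S 1 (z 1) * proposal S 0 (z 1) (z 0))
      else
        lik S t (z t) * pbar S t (z t) * transition S t (z (t + 1)) (z t)
          / (pbar S (t + 1) (z (t + 1)) * proposal S t (z (t + 1)) (z t)))"

text \<open>A configuration of \<open>N\<close> particles at time \<open>t\<close> assigns to each index below \<open>N\<close>
  its current path $z_{t:T}$.\<close>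

definition config_space ::
    "('z::euclidean_space, 'x, 'y) diffusion \<Rightarrow> nat \<Rightarrow> nat \<Rightarrow> (nat \<Rightarrow> nat \<Rightarrow> 'z) measure" where
  "config_space S N t = (\<Pi>\<^sub>M i\<in>{..<N}. path_space S t)"

definition norm_weight ::
    "('z::euclidean_space, 'x, 'y::euclidean_space) diffusion \<Rightarrow> nat \<Rightarrow> nat
      \<Rightarrow> (nat \<Rightarrow> nat \<Rightarrow> 'z) \<Rightarrow> nat \<Rightarrow> real" where
  "norm_weight S N t x i = weight S t (x i) / (\<Sum>j<N. weight S t (x j))"

definition init ::
    "('z::euclidean_space, 'x, 'y) diffusion \<Rightarrow> nat \<Rightarrow> (nat \<Rightarrow> nat \<Rightarrow> 'z) measure" where
  "init S N = distr (\<Pi>\<^sub>M i\<in>{..<N}. density lborel (\<lambda>z. ennreal (gauss 0 1 z)))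
     (config_space S N (horizon S))
     (\<lambda>z. \<lambda>i\<in>{..<N}. \<lambda>s\<in>{horizon S}. z i)"

text \<open>Multinomial resampling: the new paths are copies of the paths of ancestors \<open>a i\<close>,
  drawn independently according to the normalized weights.\<close>

definition resample ::
    "('z::euclidean_space, 'x, 'y::euclidean_space) diffusion \<Rightarrow> nat \<Rightarrow> nat
      \<Rightarrow> (nat \<Rightarrow> nat \<Rightarrow> 'z) \<Rightarrow> (nat \<Rightarrow> nat \<Rightarrow> 'z) measure" where
  "resample S N t x =
     distr (\<Pi>\<^sub>M i\<in>{..<N}. point_measure {..<N} (\<lambda>j. ennreal (norm_weight S N t x j)))
       (config_space S N t) (\<lambda>a. \<lambda>i\<in>{..<N}. x (a i))"

definition propagate ::
    "('z::euclidean_space, 'x, 'y::euclidean_space) diffusion \<Rightarrow> nat \<Rightarrow> nat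
      \<Rightarrow> (nat \<Rightarrow> nat \<Rightarrow> 'z) \<Rightarrow> (nat \<Rightarrow> nat \<Rightarrow> 'z) measure" where
  "propagate S N t x =
     distr (\<Pi>\<^sub>M i\<in>{..<N}. density lborel (\<lambda>z. ennreal (proposal S t (x i (t + 1)) z)))
       (config_space S N t) (\<lambda>z. \<lambda>i\<in>{..<N}. (x i)(t := z i))"

text \<open>The law of the configuration after \<open>k\<close> steps, that is, at time $T - k$.\<close>

primrec smc ::
    "('z::euclidean_space, 'x, 'y::euclidean_space) diffusion \<Rightarrow> nat \<Rightarrow> nat
      \<Rightarrow> (nat \<Rightarrow> nat \<Rightarrow> 'z) measure" where
  "smc S N 0 = init S N"
| "smc S N (Suc k) =
     smc S N k \<bind> (\<lambda>x. resample S N (horizon S - k) x \<bind> propagate S N (horizon S - Suc k))"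

text \<open>\<open>X\<close> is a random variable on \<open>M\<close> with the law of the configuration of \<open>N\<close> particles
  returned at time 0; the returned weights are \<open>norm_weight S N 0\<close>.\<close>

definition smc_output ::
    "('z::euclidean_space, 'x, 'y::euclidean_space) diffusion \<Rightarrow> nat \<Rightarrow> 'w measure
      \<Rightarrow> ('w \<Rightarrow> nat \<Rightarrow> nat \<Rightarrow> 'z) \<Rightarrow> bool" where
  "smc_output S N M X \<longleftrightarrow> X \<in> measurable M (config_space S N 0) \<and>
     distr M (config_space S N 0) X = smc S N (horizon S)"

definition particle_measure ::
    "('z::euclidean_space, 'x, 'y::euclidean_space) diffusion \<Rightarrow> nat
      \<Rightarrow> (nat \<Rightarrow> nat \<Rightarrow> 'z) \<Rightarrow> (nat \<Rightarrow> 'z) set \<Rightarrow> real" where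
  "particle_measure S N x E = (\<Sum>i<N. norm_weight S N 0 x i * indicator E (x i))"

end

(* Conditionally on the current configuration, resampling and propagation each draw independent
   particles, so by Hoeffding's inequality the empirical mean of a bounded function misses its
   conditional mean by eps with probability at most 2 exp(- c eps^2 N). Since these tails are
   summable in N, the claim "the deviation probabilities of the weighted mean from its limit are
   summable in N" propagates from time t + 1 to time t, however the runs with different N are
   coupled; Borel-Cantelli then gives almost sure convergence. The weighted mean of f is the
   quotient of the empirical means of w f and w, so all that is needed of the weights is that they
   are bounded: a Gaussian density is dominated by a multiple of one with larger variance,
   uniformly over means at bounded distance, and the bounded gradients keep the means of prior and
   proposal close. The factors pbar cancel along a path, so the product of proposals and weights is
   the joint density. *)
theory Submission
  imports Defs
begin

section \<open>Gaussian densities and gradients\<close>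

text \<open>After one resampling the particles are dependent, so no law of large numbers for
  independent variables applies to the configuration itself. Centring each step at its conditional
  mean avoids this, at the price of an induction over all bounded measurable functions of the whole
  path at once: a step applies the hypothesis to the function obtained by integrating the newest
  coordinate against the proposal, which is again bounded. The limits are normalized Feynman-Kac
  integrals, whose density is the Gaussian at time T times the proposals and weights down to time t.
  Their recursion in t mirrors one step of the algorithm. The integrals are finite because every
  weight is bounded above and every proposal has mass 1; they are positive because every factor is.
  An upper bound on the weights suffices: a quotient converges as soon as the limit of its
  denominator is nonzero, and here that limit is a quotient of positive integrals, or at time T such
  an integral itself. Since the test function is the indicator of a fixed set E, the exceptional
  null set may depend on E.\<close>

lemma gauss_pos: "0 < s \<Longrightarrow> 0 < gauss m s x"
  by (simp add: gauss_def prod_pos normal_density_pos)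

lemma gauss_nonneg [simp]: "0 \<le> gauss m s x"
  by (simp add: gauss_def prod_nonneg)

lemma measurable_gauss [measurable]:
  assumes [measurable]: "m \<in> borel_measurable M" "x \<in> borel_measurable M"
  shows "(\<lambda>w. gauss (m w) s (x w)) \<in> borel_measurable M"
  unfolding gauss_def normal_density_def by measurable

lemma nn_integral_gauss:
  assumes "0 < s"
  shows "(\<integral>\<^sup>+x. ennreal (gauss m s x) \<partial>lborel) = 1"
proof -
  have "(\<integral>\<^sup>+x. ennreal (gauss m s x) \<partial>lborel)
      = (\<integral>\<^sup>+x. (\<Prod>b\<in>Basis. ennreal (normal_density (m \<bullet> b) s (x \<bullet> b))) \<partial>lborel)"
    by (simp add: gauss_def prod_ennreal)
  also have "\<dots> = (\<Prod>b\<in>Basis. \<integral>\<^sup>+x. ennreal (normal_density (m \<bullet> b) s x) \<partial>lborel)"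
    by (rule nn_integral_lborel_prod) auto
  also have "\<dots> = 1"
    using assms by (simp add: nn_integral_eq_integral)
  finally show ?thesis .
qed

lemma prob_space_gauss: "0 < s \<Longrightarrow> prob_space (density lborel (\<lambda>x. ennreal (gauss m s x)))"
  by (rule prob_spaceI) (simp add: emeasure_density nn_integral_gauss)

text \<open>Cauchy-Schwarz in Engel form: the difference of the two sides is a perfect square over a
  positive denominator.\<close>

lemma square_sum_div_le:
  fixes a b u v :: real
  assumes "0 < a" "0 < b"
  shows "(u + v)\<^sup>2 / (a + b) \<le> u\<^sup>2 / a + v\<^sup>2 / b"
proof -
  have "u\<^sup>2 / a + v\<^sup>2 / b - (u + v)\<^sup>2 / (a + b) = (u * b - v * a)\<^sup>2 / (a * b * (a + b))"
    using assms by (simp add: divide_simps) (simp add: power2_eq_square algebra_simps)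
  also have "\<dots> \<ge> 0"
    using assms by simp
  finally show ?thesis
    by simp
qed

text \<open>The gap between the variances absorbs the shift of the mean. In the constant, r / s is
  the ratio of the normalizing factors, and the exponential is the cost of a shift by at most D,
  with the gap in its denominator.\<close>

lemma normal_density_le_wider:
  assumes "0 < s" "s\<^sup>2 < r\<^sup>2" "0 < r" "\<bar>m - n\<bar> \<le> D"
  shows "normal_density m s x \<le> r / s * exp (D\<^sup>2 / (2 * (r\<^sup>2 - s\<^sup>2))) * normal_density n r x"
proof -
  \<comment> \<open>These two facts keep the quotients opaque, so that the comparison of the
    exponents is purely linear.\<close>
  have half: "a / (2 * c) = a / c / 2" for a c :: real
    by simp
  have halve: "- (q / 2) \<le> d' / 2 + - (p / 2)" if "p \<le> q + d" "d \<le> d'" for p q d d' :: real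
    using that by linarith
  \<comment> \<open>Split x - n as (x - m) + (m - n) and r^2 as s^2 + (r^2 - s^2).\<close>
  have "(x - n)\<^sup>2 / r\<^sup>2 \<le> (x - m)\<^sup>2 / s\<^sup>2 + (m - n)\<^sup>2 / (r\<^sup>2 - s\<^sup>2)"
    using square_sum_div_le[of "s\<^sup>2" "r\<^sup>2 - s\<^sup>2" "x - m" "m - n"] assms by simp
  moreover have "(m - n)\<^sup>2 / (r\<^sup>2 - s\<^sup>2) \<le> D\<^sup>2 / (r\<^sup>2 - s\<^sup>2)"
  proof (rule divide_right_mono)
    show "(m - n)\<^sup>2 \<le> D\<^sup>2"
      using power_mono[of "\<bar>m - n\<bar>" D 2] assms(4) by simp
    show "0 \<le> r\<^sup>2 - s\<^sup>2"
      using assms(2) by linarith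
  qed
  ultimately have "- (x - m)\<^sup>2 / (2 * s\<^sup>2) \<le> D\<^sup>2 / (2 * (r\<^sup>2 - s\<^sup>2)) + - (x - n)\<^sup>2 / (2 * r\<^sup>2)"
    unfolding half minus_divide_left[symmetric] by (rule halve)
  then have "exp (- (x - m)\<^sup>2 / (2 * s\<^sup>2))
      \<le> exp (D\<^sup>2 / (2 * (r\<^sup>2 - s\<^sup>2))) * exp (- (x - n)\<^sup>2 / (2 * r\<^sup>2))"
    by (simp add: exp_add[symmetric])
  then have "normal_density m s x \<le> 1 / sqrt (2 * pi * s\<^sup>2)
      * (exp (D\<^sup>2 / (2 * (r\<^sup>2 - s\<^sup>2))) * exp (- (x - n)\<^sup>2 / (2 * r\<^sup>2)))"
    unfolding normal_density_def by (intro mult_left_mono) auto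
  also have "\<dots> = r / s * exp (D\<^sup>2 / (2 * (r\<^sup>2 - s\<^sup>2))) * normal_density n r x"
    using assms unfolding normal_density_def by (simp add: real_sqrt_mult)
  finally show ?thesis .
qed

text \<open>An isotropic Gaussian is a product over coordinates, and each coordinate of m - n is at
  most its norm; hence the one-dimensional constant to the power of the dimension.\<close>

lemma gauss_le_wider:
  fixes m n x :: "'a::euclidean_space"
  assumes "0 < s" "s\<^sup>2 < r\<^sup>2" "0 < r" "norm (m - n) \<le> D"
  shows "gauss m s x \<le> (r / s * exp (D\<^sup>2 / (2 * (r\<^sup>2 - s\<^sup>2)))) ^ DIM('a) * gauss n r x"
proof -
  have "\<bar>m \<bullet> b - n \<bullet> b\<bar> \<le> D" if "b \<in> Basis" for b
    using Basis_le_norm[OF that, of "m - n"] assms by (simp add: inner_diff_left)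
  then have "gauss m s x \<le> (\<Prod>b\<in>Basis. r / s * exp (D\<^sup>2 / (2 * (r\<^sup>2 - s\<^sup>2)))
      * normal_density (n \<bullet> b) r (x \<bullet> b))"
    unfolding gauss_def using assms
    by (intro prod_mono conjI normal_density_le_wider) auto
  then show ?thesis
    by (simp only: gauss_def prod.distrib prod_constant power_mult_distrib)
qed

section \<open>Existence and measurability of gradients\<close>

text \<open>\<open>grad\<close> is a definite description, so both existence and uniqueness are due.
  Existence is the Riesz representation of the derivative, written out in the basis.\<close>

lemma GDERIV_grad:
  assumes "f differentiable (at x)"
  shows "GDERIV f x :> grad f x"
proof -
  obtain f' where f': "(f has_derivative f') (at x)"
    using assms by (auto simp: differentiable_def)
  then interpret f': bounded_linear f'
    by (rule has_derivative_bounded_linear)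
  have "f' h = h \<bullet> (\<Sum>b\<in>Basis. f' b *\<^sub>R b)" for h
  proof -
    have "f' h = f' (\<Sum>b\<in>Basis. (h \<bullet> b) *\<^sub>R b)"
      by (simp add: euclidean_representation)
    also have "\<dots> = h \<bullet> (\<Sum>b\<in>Basis. f' b *\<^sub>R b)"
      by (simp add: f'.sum f'.scaleR inner_sum_right mult.commute)
    finally show ?thesis .
  qed
  then have "f' = (\<lambda>h. h \<bullet> (\<Sum>b\<in>Basis. f' b *\<^sub>R b))"
    by (rule ext)
  then have ex: "GDERIV f x :> (\<Sum>b\<in>Basis. f' b *\<^sub>R b)"
    using f' unfolding gderiv_def by (rule has_derivative_subst[rotated])
  have unique: "g = h" if "GDERIV f x :> g" "GDERIV f x :> h" for g h
  proof -
    have "(\<lambda>v. v \<bullet> g) = (\<lambda>v. v \<bullet> h)"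
      using that unfolding gderiv_def by (rule has_derivative_unique)
    then show ?thesis
      by (metis vector_eq_rdot inner_commute)
  qed
  show ?thesis
    unfolding grad_def by (rule theI[where P = "\<lambda>g. GDERIV f x :> g", OF ex unique[OF _ ex]])
qed

text \<open>A gradient need not be continuous, but each of its components is a pointwise limit of
  difference quotients of a continuous function. This makes the guided mean of the proposal
  measurable.\<close>

lemma borel_measurable_grad:
  fixes f :: "'a::euclidean_space \<Rightarrow> real"
  assumes "\<And>x. f differentiable (at x)"
  shows "grad f \<in> borel_measurable borel"
proof (subst borel_measurable_euclidean_space, intro ballI)
  fix b :: 'a
  have "continuous_on UNIV f"
    using assms by (simp add: continuous_on_eq_continuous_at differentiable_imp_continuous_within)
  then have [measurable]: "f \<in> borel_measurable borel"
    by (rule borel_measurable_continuous_onI)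
  have "(\<lambda>n. (f (x + (1 / real (Suc n)) *\<^sub>R b) - f x) / (1 / real (Suc n))) \<longlonglongrightarrow> grad f x \<bullet> b" for x
  proof -
    have "((\<lambda>t. f (x + t *\<^sub>R b)) has_derivative (\<lambda>t. (t *\<^sub>R b) \<bullet> grad f x)) (at 0)"
    proof (rule has_derivative_compose[where g = f])
      show "((\<lambda>t. x + t *\<^sub>R b) has_derivative (\<lambda>t. t *\<^sub>R b)) (at 0)"
        by (auto intro!: derivative_eq_intros)
      show "(f has_derivative (\<lambda>v. v \<bullet> grad f x)) (at (x + 0 *\<^sub>R b))"
        using GDERIV_grad[OF assms] by (simp add: gderiv_def)
    qed
    then have "((\<lambda>t. f (x + t *\<^sub>R b)) has_real_derivative (grad f x \<bullet> b)) (at 0)"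
      unfolding has_field_derivative_def
      by (rule has_derivative_subst) (simp add: inner_commute fun_eq_iff)
    then have "((\<lambda>t. (f (x + t *\<^sub>R b) - f x) / t) \<longlongrightarrow> grad f x \<bullet> b) (at 0)"
      by (simp add: has_field_derivative_iff)
    moreover have "filterlim (\<lambda>n. 1 / real (Suc n)) (at 0) sequentially"
      unfolding filterlim_at using LIMSEQ_Suc[OF lim_1_over_n] by auto
    ultimately show ?thesis
      by (rule filterlim_compose)
  qed
  then show "(\<lambda>x. grad f x \<bullet> b) \<in> borel_measurable borel"
    by (rule borel_measurable_LIMSEQ_real) measurable
qed

section \<open>Concentration and complete convergence\<close>

text \<open>Independence means that the joint law is the product of the marginals; on a product
  space the tuple of coordinates is the identity.\<close>

lemma indep_vars_PiM_coordinates: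
  assumes "I \<noteq> {}" "\<And>i. i \<in> I \<Longrightarrow> prob_space (Q i)"
  shows "prob_space.indep_vars (Pi\<^sub>M I Q) Q (\<lambda>i z. z i) I"
proof -
  interpret prob_space "Pi\<^sub>M I Q"
    using assms(2) by (rule prob_space_PiM)
  have "distr (Pi\<^sub>M I Q) (Pi\<^sub>M I Q) (\<lambda>z. \<lambda>i\<in>I. z i) = distr (Pi\<^sub>M I Q) (Pi\<^sub>M I Q) (\<lambda>z. z)"
    by (rule distr_cong) (auto simp: space_PiM PiE_def extensional_restrict)
  also have "\<dots> = (\<Pi>\<^sub>M i\<in>I. distr (Pi\<^sub>M I Q) (Q i) (\<lambda>z. z i))"
    using assms by (simp add: distr_id2 distr_PiM_component cong: PiM_cong)
  finally show ?thesis
    using assms by (subst indep_vars_iff_distr_eq_PiM') auto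
qed

text \<open>The factors \<open>Q i\<close> may differ, as they do in propagation, where every
  particle moves from its own position. The bound depends on them only through B, which makes it
  uniform over the configurations conditioned on.\<close>

lemma Hoeffding_PiM:
  fixes f :: "nat \<Rightarrow> 'a \<Rightarrow> real"
  assumes "0 < N" "0 < B" "0 \<le> \<epsilon>"
    and Q: "\<And>i. i < N \<Longrightarrow> prob_space (Q i)"
    and f: "\<And>i. i < N \<Longrightarrow> f i \<in> borel_measurable (Q i)"
    and bound: "\<And>i z. i < N \<Longrightarrow> z \<in> space (Q i) \<Longrightarrow> \<bar>f i z\<bar> \<le> B"
  shows "measure (Pi\<^sub>M {..<N} Q) {z \<in> space (Pi\<^sub>M {..<N} Q).
      \<epsilon> \<le> \<bar>(\<Sum>i<N. f i (z i)) / real N - (\<Sum>i<N. integral\<^sup>L (Q i) (f i)) / real N\<bar>}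
    \<le> 2 * exp (- (1 / (2 * B\<^sup>2) * \<epsilon>\<^sup>2) * real N)"
proof -
  let ?P = "Pi\<^sub>M {..<N} Q"
  interpret prob_space ?P
    using Q by (intro prob_space_PiM) auto
  have mean: "expectation (\<lambda>z. f i (z i)) = integral\<^sup>L (Q i) (f i)" if "i < N" for i
    using distr_PiM_component[of "{..<N}" Q i] Q f that
    by (metis integral_distr lessThan_iff measurable_component_singleton)
  interpret Hoeffding_ineq ?P "{..<N}" "\<lambda>i z. f i (z i)" "\<lambda>_. - B" "\<lambda>_. B"
    "\<Sum>i<N. integral\<^sup>L (Q i) (f i)"
  proof unfold_locales
    show "indep_vars (\<lambda>_. borel) (\<lambda>i z. f i (z i)) {..<N}"
      using assms
      by (intro indep_vars_compose2[OF indep_vars_PiM_coordinates, where Y = f]) auto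
    show "AE z in ?P. f i (z i) \<in> {- B..B}" if "i \<in> {..<N}" for i
      using bound[of i] that by (intro AE_I2) (auto simp: space_PiM PiE_iff abs_le_iff minus_le_iff)
  qed (auto simp: mean)
  have "{z \<in> space ?P. \<epsilon> \<le> \<bar>(\<Sum>i<N. f i (z i)) / real N - (\<Sum>i<N. integral\<^sup>L (Q i) (f i)) / real N\<bar>}
    = {z \<in> space ?P. \<epsilon> * real N \<le> \<bar>(\<Sum>i<N. f i (z i)) - (\<Sum>i<N. integral\<^sup>L (Q i) (f i))\<bar>}"
    using \<open>0 < N\<close> by (simp add: diff_divide_distrib[symmetric] pos_le_divide_eq)
  also have "prob \<dots> \<le> 2 * exp (- 2 * (\<epsilon> * real N)\<^sup>2 / (\<Sum>i<N. (B - - B)\<^sup>2))"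
    using assms by (intro Hoeffding_ineq_abs_ge) auto
  \<comment> \<open>Every range has width 2 B, so the squared widths add up to 4 N B^2.\<close>
  also have "- 2 * (\<epsilon> * real N)\<^sup>2 / (\<Sum>i<N. (B - - B)\<^sup>2) = - (1 / (2 * B\<^sup>2) * \<epsilon>\<^sup>2) * real N"
    using assms by (simp add: field_simps power2_eq_square)
  finally show ?thesis .
qed

section \<open>Measurability of product kernels and of kernels with densities\<close>

text \<open>Measurability in the parameter is checked on the generating cylinders, whose product
  measure is a finite product of measurable functions.\<close>

lemma measurable_PiM_prob_algebra:
  assumes "finite I" and K: "\<And>i. i \<in> I \<Longrightarrow> K i \<in> M \<rightarrow>\<^sub>M prob_algebra (N i)"
  shows "(\<lambda>x. Pi\<^sub>M I (\<lambda>i. K i x)) \<in> M \<rightarrow>\<^sub>M prob_algebra (Pi\<^sub>M I N)"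
proof (rule measurable_prob_algebra_generated[OF sets_PiM Int_stable_prod_algebra prod_algebra_sets_into_space])
  have Kx: "prob_space (K i x)" "sets (K i x) = sets (N i)" if "i \<in> I" "x \<in> space M" for i x
    using measurable_space[OF K[OF that(1)] that(2)] by (auto simp: space_prob_algebra)
  show "prob_space (Pi\<^sub>M I (\<lambda>i. K i x))" if "x \<in> space M" for x
    using Kx that by (intro prob_space_PiM) auto
  show "sets (Pi\<^sub>M I (\<lambda>i. K i x)) = sets (Pi\<^sub>M I N)" if "x \<in> space M" for x
    using Kx that by (intro sets_PiM_cong) auto
  fix A assume "A \<in> prod_algebra I N"
  then obtain J E where A: "A = prod_emb I N J (\<Pi>\<^sub>E j\<in>J. E j)" "finite J" "J \<subseteq> I"
      "\<And>i. i \<in> J \<Longrightarrow> E i \<in> sets (N i)"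
    by (rule prod_algebraE) (rule that, simp_all)
  have "emeasure (Pi\<^sub>M I (\<lambda>i. K i x)) A = (\<Prod>j\<in>J. emeasure (K j x) (E j))" if x: "x \<in> space M" for x
  proof -
    have "A = prod_emb I (\<lambda>i. K i x) J (\<Pi>\<^sub>E j\<in>J. E j)"
      unfolding A(1) prod_emb_def using Kx(2)[OF _ x, THEN sets_eq_imp_space_eq]
      by (auto simp: PiE_iff)
    then show ?thesis
      using A Kx x by (simp only:) (rule emeasure_PiM_emb, auto)
  qed
  moreover have "(\<lambda>x. \<Prod>j\<in>J. emeasure (K j x) (E j)) \<in> borel_measurable M"
  proof (rule borel_measurable_prod_ennreal)
    fix j assume j: "j \<in> J"
    show "(\<lambda>x. emeasure (K j x) (E j)) \<in> borel_measurable M"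
      using measurable_compose[OF measurable_prob_algebraD[OF K] measurable_emeasure_subprob_algebra]
        j A by blast
  qed
  ultimately show "(\<lambda>x. emeasure (Pi\<^sub>M I (\<lambda>i. K i x)) A) \<in> borel_measurable M"
    by (simp cong: measurable_cong)
qed

text \<open>One source for both random draws: ancestors have a density with respect to counting
  measure, proposals with respect to Lebesgue measure.\<close>

lemma measurable_density_prob_algebra:
  assumes "sigma_finite_measure L"
    and f [measurable]: "(\<lambda>(x, z). f x z) \<in> borel_measurable (M \<Otimes>\<^sub>M L)"
    and total: "\<And>x. x \<in> space M \<Longrightarrow> (\<integral>\<^sup>+z. f x z \<partial>L) = 1"
  shows "(\<lambda>x. density L (f x)) \<in> M \<rightarrow>\<^sub>M prob_algebra L"
proof (rule measurable_prob_algebraI)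
  interpret sigma_finite_measure L by fact
  have f': "f x \<in> borel_measurable L" if "x \<in> space M" for x
    using measurable_compose[OF measurable_Pair1'[OF that] f] by simp
  show prob: "prob_space (density L (f x))" if "x \<in> space M" for x
    using f'[OF that] total[OF that] by (intro prob_spaceI) (simp add: emeasure_density cong: nn_integral_cong)
  show "(\<lambda>x. density L (f x)) \<in> M \<rightarrow>\<^sub>M subprob_algebra L"
  proof (rule measurable_subprob_algebra)
    fix A assume [measurable]: "A \<in> sets L"
    have "(\<lambda>x. \<integral>\<^sup>+z. f x z * indicator A z \<partial>L) \<in> borel_measurable M"
      by measurable
    then show "(\<lambda>x. emeasure (density L (f x)) A) \<in> borel_measurable M"
      by (simp add: emeasure_density f' cong: measurable_cong)
  qed (auto intro: prob_space_imp_subprob_space prob)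
qed

section \<open>Complete convergence to a constant\<close>

text \<open>The indices start at 1: \<open>smc_output\<close> says nothing about the run with 0 particles.\<close>

definition converges_completely ::
    "(nat \<Rightarrow> 'a measure) \<Rightarrow> (nat \<Rightarrow> 'a \<Rightarrow> real) \<Rightarrow> real \<Rightarrow> bool" where
  "converges_completely P Y l \<longleftrightarrow> (\<forall>\<epsilon>>0. summable (\<lambda>n.
     measure (P (Suc n)) {x \<in> space (P (Suc n)). \<epsilon> \<le> \<bar>Y (Suc n) x - l\<bar>}))"

text \<open>Both limits are constants, so continuity of division at the single point (a, b) gives
  one tolerance d. A deviation of the quotient then forces a deviation by d / 2 of numerator or
  denominator, and the two summable tails add. Values of Z equal to 0 are covered, being among the
  points p.\<close>

lemma converges_completely_divide:
  assumes P: "\<And>N. 0 < N \<Longrightarrow> P N \<in> space (prob_algebra (A N))"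
    and Y: "\<And>N. 0 < N \<Longrightarrow> Y N \<in> borel_measurable (A N)"
    and Z: "\<And>N. 0 < N \<Longrightarrow> Z N \<in> borel_measurable (A N)"
    and "converges_completely P Y a" "converges_completely P Z b" "b \<noteq> 0"
  shows "converges_completely P (\<lambda>N x. Y N x / Z N x) (a / b)"
  unfolding converges_completely_def
proof (intro allI impI)
  fix \<epsilon> :: real assume "0 < \<epsilon>"
  have "isCont (\<lambda>p. fst p / snd p) (a, b)"
    using \<open>b \<noteq> 0\<close> by (intro continuous_intros) auto
  then obtain d where "0 < d"
    and d: "\<And>p. dist p (a, b) < d \<Longrightarrow> dist (fst p / snd p) (a / b) < \<epsilon>"
    using \<open>0 < \<epsilon>\<close> unfolding continuous_at_eps_delta by force
  let ?S = "\<lambda>Y l \<epsilon> n. {x \<in> space (P (Suc n)). \<epsilon> \<le> \<bar>Y (Suc n) x - l\<bar>}"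
  show "summable (\<lambda>n. measure (P (Suc n)) (?S (\<lambda>N x. Y N x / Z N x) (a / b) \<epsilon> n))"
  proof (rule summable_comparison_test')
    show "summable (\<lambda>n. measure (P (Suc n)) (?S Y a (d / 2) n) + measure (P (Suc n)) (?S Z b (d / 2) n))"
      using \<open>0 < d\<close>
      by (intro summable_add assms(4,5)[unfolded converges_completely_def, rule_format]) simp_all
    fix n :: nat
    interpret prob_space "P (Suc n)"
      using P[of "Suc n"] by (simp add: space_prob_algebra)
    have sets: "sets (P (Suc n)) = sets (A (Suc n))"
      using P[of "Suc n"] by (simp add: space_prob_algebra)
    have [measurable]: "Y (Suc n) \<in> borel_measurable (P (Suc n))" "Z (Suc n) \<in> borel_measurable (P (Suc n))"
      using Y[of "Suc n"] Z[of "Suc n"] by (simp_all add: measurable_cong_sets[OF sets refl])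
    have "\<bar>Y (Suc n) x / Z (Suc n) x - a / b\<bar> < \<epsilon>"
      if "\<bar>Y (Suc n) x - a\<bar> < d / 2" "\<bar>Z (Suc n) x - b\<bar> < d / 2" for x
    proof -
      have "dist (Y (Suc n) x, Z (Suc n) x) (a, b) \<le> \<bar>Y (Suc n) x - a\<bar> + \<bar>Z (Suc n) x - b\<bar>"
        by (simp add: dist_Pair_Pair dist_real_def) (rule sqrt_sum_squares_le_sum_abs)
      then show ?thesis
        using d[of "(Y (Suc n) x, Z (Suc n) x)"] that by (simp add: dist_real_def)
    qed
    then have "?S (\<lambda>N x. Y N x / Z N x) (a / b) \<epsilon> n \<subseteq> ?S Y a (d / 2) n \<union> ?S Z b (d / 2) n"
      by (auto simp: not_less[symmetric])
    then have "prob (?S (\<lambda>N x. Y N x / Z N x) (a / b) \<epsilon> n) \<le> prob (?S Y a (d / 2) n \<union> ?S Z b (d / 2) n)"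
      by (intro finite_measure_mono) auto
    also have "\<dots> \<le> prob (?S Y a (d / 2) n) + prob (?S Z b (d / 2) n)"
      by (intro measure_Un_le) auto
    finally show "norm (prob (?S (\<lambda>N x. Y N x / Z N x) (a / b) \<epsilon> n))
        \<le> prob (?S Y a (d / 2) n) + prob (?S Z b (d / 2) n)"
      by simp
  qed
qed

lemma summable_exp_tail: "0 < c \<Longrightarrow> summable (\<lambda>n. 2 * exp (- c * real (Suc n)))"
proof -
  assume "0 < c"
  then have "summable (\<lambda>n. 2 * exp (- c) * exp (- c) ^ n)"
    by (intro summable_mult summable_geometric) simp
  moreover have "2 * exp (- c) * exp (- c) ^ n = 2 * exp (- c * real (Suc n))" for n
    by (simp add: exp_of_nat_mult[symmetric] exp_add[symmetric] algebra_simps)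
  ultimately show ?thesis
    by simp
qed

lemma converges_completely_Hoeffding:
  assumes "0 < c"
    and tail: "\<And>N \<epsilon>. 0 < N \<Longrightarrow> 0 < \<epsilon> \<Longrightarrow>
      measure (P N) {y \<in> space (P N). \<epsilon> \<le> \<bar>G N y - l\<bar>} \<le> 2 * exp (- (c * \<epsilon>\<^sup>2) * real N)"
  shows "converges_completely P G l"
  unfolding converges_completely_def
proof (intro allI impI)
  fix \<epsilon> :: real assume "0 < \<epsilon>"
  show "summable (\<lambda>n. measure (P (Suc n)) {x \<in> space (P (Suc n)). \<epsilon> \<le> \<bar>G (Suc n) x - l\<bar>})"
  proof (rule summable_comparison_test')
    show "summable (\<lambda>n. 2 * exp (- (c * \<epsilon>\<^sup>2) * real (Suc n)))"
      using \<open>0 < c\<close> \<open>0 < \<epsilon>\<close> by (intro summable_exp_tail) simp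
    show "norm (measure (P (Suc n)) {x \<in> space (P (Suc n)). \<epsilon> \<le> \<bar>G (Suc n) x - l\<bar>})
        \<le> 2 * exp (- (c * \<epsilon>\<^sup>2) * real (Suc n))" for n
      using tail[of "Suc n" \<epsilon>] \<open>0 < \<epsilon>\<close> by simp
  qed
qed

text \<open>H is the conditional mean of G. If G misses l by eps, then either G misses H by eps / 2,
  which the conditional tail controls, or H misses l by eps / 2, which is a summable event before
  the kernel is applied. It is essential that c depends neither on N nor on x.\<close>

lemma converges_completely_bind:
  assumes "0 < c"
    and P: "\<And>N. 0 < N \<Longrightarrow> P N \<in> space (prob_algebra (A N))"
    and K: "\<And>N. 0 < N \<Longrightarrow> K N \<in> A N \<rightarrow>\<^sub>M prob_algebra (B N)"
    and G: "\<And>N. 0 < N \<Longrightarrow> G N \<in> borel_measurable (B N)"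
    and H: "\<And>N. 0 < N \<Longrightarrow> H N \<in> borel_measurable (A N)"
    and tail: "\<And>N x \<epsilon>. 0 < N \<Longrightarrow> 0 < \<epsilon> \<Longrightarrow> x \<in> space (A N) \<Longrightarrow>
      measure (K N x) {y \<in> space (B N). \<epsilon> \<le> \<bar>G N y - H N x\<bar>} \<le> 2 * exp (- (c * \<epsilon>\<^sup>2) * real N)"
    and "converges_completely P H l"
  shows "converges_completely (\<lambda>N. P N \<bind> K N) G l"
  unfolding converges_completely_def
proof (intro allI impI)
  fix \<epsilon> :: real assume "0 < \<epsilon>"
  let ?S = "\<lambda>n. {y \<in> space (P (Suc n) \<bind> K (Suc n)). \<epsilon> \<le> \<bar>G (Suc n) y - l\<bar>}"
  let ?T = "\<lambda>n. {x \<in> space (P (Suc n)). \<epsilon> / 2 \<le> \<bar>H (Suc n) x - l\<bar>}"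
  let ?e = "\<lambda>n. 2 * exp (- (c * (\<epsilon> / 2)\<^sup>2) * real (Suc n))"
  show "summable (\<lambda>n. measure (P (Suc n) \<bind> K (Suc n)) (?S n))"
  proof (rule summable_comparison_test')
    show "summable (\<lambda>n. ?e n + measure (P (Suc n)) (?T n))"
      using \<open>0 < c\<close> \<open>0 < \<epsilon>\<close>
      by (intro summable_add summable_exp_tail assms(7)[unfolded converges_completely_def, rule_format]) simp_all
    fix n :: nat
    note K' = K[of "Suc n", simplified] and P' = P[of "Suc n", simplified]
    interpret prob_space "P (Suc n)"
      using P' by (simp add: space_prob_algebra)
    have sets: "sets (P (Suc n)) = sets (A (Suc n))"
      using P' by (simp add: space_prob_algebra)
    have space: "space (P (Suc n)) = space (A (Suc n))"
      by (rule sets_eq_imp_space_eq[OF sets])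
    have spaceB: "space (P (Suc n) \<bind> K (Suc n)) = space (B (Suc n))"
      by (rule sets_eq_imp_space_eq[OF sets_bind'[OF P' K']])
    note [measurable] = G[of "Suc n", simplified] H[of "Suc n", simplified]
    have [measurable]: "H (Suc n) \<in> borel_measurable (P (Suc n))"
      by (simp add: measurable_cong_sets[OF sets refl])
    have S: "?S n \<in> sets (B (Suc n))"
      unfolding spaceB by measurable
    have "emeasure (P (Suc n) \<bind> K (Suc n)) (?S n) = (\<integral>\<^sup>+x. emeasure (K (Suc n) x) (?S n) \<partial>P (Suc n))"
      by (rule emeasure_bind_prob_algebra[OF P' K' S])
    \<comment> \<open>On \<open>?T\<close> the conditional probability is bounded by 1, for which
      the indicator pays; off \<open>?T\<close> the tail at eps / 2 applies.\<close>
    also have "\<dots> \<le> (\<integral>\<^sup>+x. ennreal (?e n) + indicator (?T n) x \<partial>P (Suc n))"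
    proof (rule nn_integral_mono)
      fix x assume x: "x \<in> space (P (Suc n))"
      then interpret Kx: prob_space "K (Suc n) x"
        using measurable_space[OF K'] by (simp add: space space_prob_algebra)
      have sets_Kx: "sets (K (Suc n) x) = sets (B (Suc n))"
        using measurable_space[OF K'] x by (simp add: space space_prob_algebra)
      show "emeasure (K (Suc n) x) (?S n) \<le> ennreal (?e n) + indicator (?T n) x"
      proof (cases "x \<in> ?T n")
        case True
        then show ?thesis
          using Kx.emeasure_le_1 by (simp add: add_increasing)
      next
        case False
        then have "\<bar>H (Suc n) x - l\<bar> < \<epsilon> / 2"
          using x by simp
        then have far: "\<epsilon> / 2 \<le> \<bar>G (Suc n) y - H (Suc n) x\<bar>" if "\<epsilon> \<le> \<bar>G (Suc n) y - l\<bar>" for y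
          using that by linarith
        have "?S n \<subseteq> {y \<in> space (B (Suc n)). \<epsilon> / 2 \<le> \<bar>G (Suc n) y - H (Suc n) x\<bar>}"
          using far by (auto simp: spaceB)
        then have "measure (K (Suc n) x) (?S n) \<le> measure (K (Suc n) x)
            {y \<in> space (B (Suc n)). \<epsilon> / 2 \<le> \<bar>G (Suc n) y - H (Suc n) x\<bar>}"
          by (intro Kx.finite_measure_mono) (auto simp: sets_Kx)
        also have "\<dots> \<le> ?e n"
          using tail[of "Suc n" "\<epsilon> / 2" x] x \<open>0 < \<epsilon>\<close> by (simp add: space)
        finally show ?thesis
          using False by (simp add: Kx.emeasure_eq_measure)
      qed
    qed
    also have "\<dots> = ennreal (?e n) + emeasure (P (Suc n)) (?T n)"
      by (subst nn_integral_add) (auto simp: emeasure_space_1)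
    also have "\<dots> = ennreal (?e n + measure (P (Suc n)) (?T n))"
      by (simp add: emeasure_eq_measure)
    finally have "measure (P (Suc n) \<bind> K (Suc n)) (?S n) \<le> ?e n + measure (P (Suc n)) (?T n)"
      unfolding measure_def[of "_ \<bind> _"] by (intro enn2real_leI) auto
    then show "norm (measure (P (Suc n) \<bind> K (Suc n)) (?S n)) \<le> ?e n + measure (P (Suc n)) (?T n)"
      by simp
  qed
qed

text \<open>Each event of Borel-Cantelli involves a single \<open>X N\<close>, so its probability
  can be computed under the law \<open>P N\<close>. The tolerances 1 / (k + 1) reduce the claim to
  countably many null sets.\<close>

lemma converges_completely_imp_AE:
  assumes "prob_space M"
    and X: "\<And>N. 0 < N \<Longrightarrow> X N \<in> M \<rightarrow>\<^sub>M A N"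
    and P: "\<And>N. 0 < N \<Longrightarrow> distr M (A N) (X N) = P N"
    and Y: "\<And>N. 0 < N \<Longrightarrow> Y N \<in> borel_measurable (A N)"
    and "converges_completely P Y l"
  shows "AE \<omega> in M. (\<lambda>N. Y N (X N \<omega>)) \<longlonglongrightarrow> l"
proof -
  interpret prob_space M by fact
  have "AE \<omega> in M. \<forall>\<^sub>F n in sequentially. \<bar>Y (Suc n) (X (Suc n) \<omega>) - l\<bar> < 1 / real (Suc k)" for k :: nat
  proof -
    let ?\<epsilon> = "1 / real (Suc k)"
    let ?A = "\<lambda>n. {\<omega> \<in> space M. ?\<epsilon> \<le> \<bar>Y (Suc n) (X (Suc n) \<omega>) - l\<bar>}"
    have [measurable]: "(\<lambda>\<omega>. Y (Suc n) (X (Suc n) \<omega>)) \<in> borel_measurable M" for n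
      by (rule measurable_compose[OF X Y]) auto
    have "measure M (?A n) = measure (P (Suc n)) {x \<in> space (P (Suc n)). ?\<epsilon> \<le> \<bar>Y (Suc n) x - l\<bar>}" for n
    proof -
      note [measurable] = Y[of "Suc n", simplified] X[of "Suc n", simplified]
      have "space (P (Suc n)) = space (A (Suc n))"
        using P[of "Suc n"] by (metis space_distr zero_less_Suc)
      moreover have "X (Suc n) -` {x \<in> space (A (Suc n)). ?\<epsilon> \<le> \<bar>Y (Suc n) x - l\<bar>} \<inter> space M = ?A n"
        using measurable_space[OF X[of "Suc n"]] by auto
      ultimately show ?thesis
        by (subst P[symmetric, of "Suc n"]) (simp_all add: measure_distr)
    qed
    then have "summable (\<lambda>n. measure M (?A n))"
      using assms(5) unfolding converges_completely_def by simp
    then have "AE \<omega> in M. \<forall>\<^sub>F n in sequentially. \<omega> \<in> space M - ?A n"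
      by (intro borel_cantelli_AE1) (auto simp: emeasure_eq_measure)
    then show ?thesis
      by (rule AE_mp) (intro AE_I2 impI, elim eventually_mono, auto)
  qed
  then have "AE \<omega> in M. \<forall>k. \<forall>\<^sub>F n in sequentially. \<bar>Y (Suc n) (X (Suc n) \<omega>) - l\<bar> < 1 / real (Suc k)"
    by (subst AE_all_countable) blast
  then show ?thesis
  proof (rule AE_mp, intro AE_I2 impI)
    fix \<omega> assume small: "\<forall>k. \<forall>\<^sub>F n in sequentially. \<bar>Y (Suc n) (X (Suc n) \<omega>) - l\<bar> < 1 / real (Suc k)"
    have "(\<lambda>n. Y (Suc n) (X (Suc n) \<omega>)) \<longlonglongrightarrow> l"
    proof (rule tendstoI)
      fix e :: real assume "0 < e"
      then obtain k where "1 / real (Suc k) < e"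
        using nat_approx_posE by blast
      then show "\<forall>\<^sub>F n in sequentially. dist (Y (Suc n) (X (Suc n) \<omega>)) l < e"
        using small[rule_format, of k] by (auto simp: dist_real_def elim!: eventually_mono)
    qed
    \<comment> \<open>Back from the indices \<open>Suc n\<close> to all N; the first term does not
      affect the limit.\<close>
    then show "(\<lambda>N. Y N (X N \<omega>)) \<longlonglongrightarrow> l"
      by (rule LIMSEQ_imp_Suc)
  qed
qed

text \<open>Agreement is asked for positive N because the identities used to rewrite, such as
  \<open>weighted_mean_eq\<close>, are available there.\<close>

lemma converges_completely_cong:
  assumes "\<And>N. 0 < N \<Longrightarrow> P N = P' N" "\<And>N x. 0 < N \<Longrightarrow> Y N x = Y' N x" "l = l'"
  shows "converges_completely P Y l \<longleftrightarrow> converges_completely P' Y' l'"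
  using assms unfolding converges_completely_def by simp

text \<open>Initialization, resampling and propagation are all pushforwards of a product measure
  under a map whose i-th particle depends only on the i-th draw. This is their common tail
  bound.\<close>

lemma Hoeffding_distr_PiM:
  fixes h :: "'b \<Rightarrow> real" and f :: "nat \<Rightarrow> 'a \<Rightarrow> real"
  assumes "0 < N" "0 < B" "0 \<le> \<epsilon>"
    and Q: "\<And>i. i < N \<Longrightarrow> prob_space (Q i)"
    and f: "\<And>i. i < N \<Longrightarrow> f i \<in> borel_measurable (Q i)"
    and bound: "\<And>i z. i < N \<Longrightarrow> z \<in> space (Q i) \<Longrightarrow> \<bar>f i z\<bar> \<le> B"
    and \<phi>: "\<phi> \<in> Pi\<^sub>M {..<N} Q \<rightarrow>\<^sub>M Pi\<^sub>M {..<N} C"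
    and h: "\<And>i. i < N \<Longrightarrow> h \<in> borel_measurable (C i)"
    and h\<phi>: "\<And>i z. i < N \<Longrightarrow> z \<in> space (Pi\<^sub>M {..<N} Q) \<Longrightarrow> h (\<phi> z i) = f i (z i)"
  shows "measure (distr (Pi\<^sub>M {..<N} Q) (Pi\<^sub>M {..<N} C) \<phi>) {y \<in> space (Pi\<^sub>M {..<N} C).
      \<epsilon> \<le> \<bar>(\<Sum>i<N. h (y i)) / real N - (\<Sum>i<N. integral\<^sup>L (Q i) (f i)) / real N\<bar>}
    \<le> 2 * exp (- (1 / (2 * B\<^sup>2) * \<epsilon>\<^sup>2) * real N)" (is "measure _ ?S \<le> ?e")
proof -
  have [measurable]: "(\<lambda>y. h (y i)) \<in> borel_measurable (Pi\<^sub>M {..<N} C)" if "i < N" for i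
    using measurable_compose[OF measurable_component_singleton[of i "{..<N}" C] h[OF that]] that by simp
  have "(\<lambda>y. \<Sum>i<N. h (y i)) \<in> borel_measurable (Pi\<^sub>M {..<N} C)"
    by (rule borel_measurable_sum) simp
  then have S: "?S \<in> sets (Pi\<^sub>M {..<N} C)"
    by measurable
  have sum_eq: "(\<Sum>i<N. h (\<phi> z i)) = (\<Sum>i<N. f i (z i))" if "z \<in> space (Pi\<^sub>M {..<N} Q)" for z
    using h\<phi> that by (intro sum.cong) auto
  have "\<phi> -` ?S \<inter> space (Pi\<^sub>M {..<N} Q) = {z \<in> space (Pi\<^sub>M {..<N} Q).
      \<epsilon> \<le> \<bar>(\<Sum>i<N. f i (z i)) / real N - (\<Sum>i<N. integral\<^sup>L (Q i) (f i)) / real N\<bar>}"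
    using sum_eq measurable_space[OF \<phi>] by auto
  then show ?thesis
    using Hoeffding_PiM[of N B \<epsilon> Q f] assms by (simp add: measure_distr[OF \<phi> S])
qed

definition empirical_mean :: "('a \<Rightarrow> real) \<Rightarrow> nat \<Rightarrow> (nat \<Rightarrow> 'a) \<Rightarrow> real" where
  "empirical_mean h N x = (\<Sum>i<N. h (x i)) / real N"

text \<open>The class of test functions of the induction. The bound is positive because its square
  is the denominator of the Hoeffding exponent.\<close>

definition bounded_measurable :: "'a measure \<Rightarrow> ('a \<Rightarrow> real) \<Rightarrow> bool" where
  "bounded_measurable M h \<longleftrightarrow> h \<in> borel_measurable M \<and> (\<exists>B>0. \<forall>x\<in>space M. \<bar>h x\<bar> \<le> B)"

lemma bounded_measurable_mult:
  assumes "bounded_measurable M f" "bounded_measurable M g"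
  shows "bounded_measurable M (\<lambda>x. f x * g x)"
proof -
  obtain A B where "0 < A" "\<And>x. x \<in> space M \<Longrightarrow> \<bar>f x\<bar> \<le> A" "0 < B" "\<And>x. x \<in> space M \<Longrightarrow> \<bar>g x\<bar> \<le> B"
    using assms unfolding bounded_measurable_def by blast
  then have "0 < A * B" "\<forall>x\<in>space M. \<bar>f x * g x\<bar> \<le> A * B"
    by (auto simp: abs_mult intro!: mult_mono)
  then show ?thesis
    using assms unfolding bounded_measurable_def by (auto intro!: borel_measurable_times)
qed

lemma bounded_measurable_const: "bounded_measurable M (\<lambda>_. c)"
  unfolding bounded_measurable_def by (auto intro: exI[of _ "\<bar>c\<bar> + 1"])

section \<open>Weights of the diffusion model\<close>

lemma positive_bounded_imp_le: "positive_bounded f \<Longrightarrow> \<exists>B. \<forall>x. f x \<le> B"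
  unfolding positive_bounded_def bounded_iff by (metis abs_le_D1 rangeI real_norm_def)

locale smc_model =
  fixes S :: "('z::euclidean_space, 'x::euclidean_space, 'y::euclidean_space) diffusion"
  assumes horizon_pos: "0 < horizon S"
    and alpha: "\<And>t. t \<in> {1..horizon S} \<Longrightarrow> 0 < alpha S t \<and> alpha S t < 1"
    and eta_pos: "0 < eta S" and sigma1_pos: "0 < sigma1 S" and tau_pos: "0 < tau S"
    and proposal_sd_pos: "\<And>t. t \<in> {1..horizon S} \<Longrightarrow> 0 < proposal_sd S t"
    and measurable_dec [measurable]: "dec S \<in> borel_measurable borel"
    and measurable_corr [measurable]: "corr S \<in> borel_measurable borel"
    and measurable_eps: "\<And>t. t \<in> {1..horizon S} \<Longrightarrow> (\<lambda>z. eps S z t) \<in> borel_measurable borel"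
    and lik_bounded: "\<And>t. t \<le> horizon S \<Longrightarrow> positive_bounded (lik S t)"
    and pbar_ratio_bounded: "\<And>t. t < horizon S \<Longrightarrow>
          positive_bounded (\<lambda>(z, z'). pbar S t z / pbar S (t + 1) z')"
    and pbar_last_bounded: "positive_bounded (pbar S (horizon S))"
    and pbar_grad: "\<And>t. t \<in> {1..horizon S} \<Longrightarrow> bounded_gradients (\<lambda>z. ln (pbar S t z))"
    and q_grad: "\<And>t. t < horizon S \<Longrightarrow> bounded_gradients (\<lambda>m. ln (q_of_mean S t m))"
    and sd_less: "\<And>t. t \<in> {1..horizon S} \<Longrightarrow> (prior_sd S t)\<^sup>2 < (proposal_sd S t)\<^sup>2"
begin

abbreviation "T \<equiv> horizon S"

section \<open>Positivity of the schedule and of the densities\<close>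

lemma abar_pos: "t \<le> T \<Longrightarrow> 0 < abar S t"
  unfolding abar_def using alpha by (intro prod_pos) auto

lemma abar_less_1:
  assumes "t \<in> {1..T}"
  shows "abar S t < 1"
proof -
  have "abar S t = abar S (t - 1) * alpha S t"
    using assms by (cases t) (auto simp: abar_def)
  moreover have "abar S (t - 1) \<le> 1"
    unfolding abar_def using assms alpha by (intro prod_le_1) (auto intro: less_imp_le)
  moreover have "0 < abar S (t - 1)"
    using assms by (intro abar_pos) auto
  ultimately show ?thesis
    using alpha[OF assms] by (smt (verit) mult_less_cancel_left2)
qed

lemma prior_sd_pos:
  assumes "t \<in> {1..T}"
  shows "0 < prior_sd S t"
proof (cases "t = 1")
  case False
  \<comment> \<open>Away from time 1 the factor 1 - \<open>abar S (t - 1)\<close> is positive; at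
    time 1 it would vanish.\<close>
  then have "t - 1 \<in> {1..T}"
    using assms by auto
  then show ?thesis
    using False assms alpha[OF assms] eta_pos abar_less_1[of t] abar_less_1[of "t - 1"]
    by (simp add: prior_sd_def beta_def)
qed (simp add: prior_sd_def sigma1_pos)

lemma lik_pos: "0 < lik S t z"
  unfolding lik_def by (rule gauss_pos[OF tau_pos])

lemma pbar_pos: "t \<le> T \<Longrightarrow> 0 < pbar S t z"
  unfolding pbar_def using lik_pos abar_less_1[of t] by (auto intro!: gauss_pos)

lemma transition_pos: "t < T \<Longrightarrow> 0 < transition S t z' z"
  unfolding transition_def by (intro gauss_pos prior_sd_pos) auto

lemma proposal_pos: "t < T \<Longrightarrow> 0 < proposal S t z' z"
  unfolding proposal_def by (intro gauss_pos proposal_sd_pos) auto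

section \<open>Measurability of the densities\<close>

lemma measurable_lik [measurable]: "lik S t \<in> borel_measurable borel"
  unfolding lik_def[abs_def] by measurable

lemma measurable_zbar: "t \<in> {1..T} \<Longrightarrow> zbar S t \<in> borel_measurable borel"
  unfolding zbar_def[abs_def] using measurable_eps[of t] by simp

lemma measurable_pbar: "t \<le> T \<Longrightarrow> pbar S t \<in> borel_measurable borel"
proof (cases "t = 0")
  case False
  assume "t \<le> T"
  with False have [measurable]: "zbar S t \<in> borel_measurable borel"
    by (intro measurable_zbar) auto
  show ?thesis
    using False unfolding pbar_def[abs_def] by simp
qed (simp add: pbar_def[abs_def])

lemma measurable_mu: "t \<in> {1..T} \<Longrightarrow> mu S t \<in> borel_measurable borel"
  using measurable_zbar[of t] measurable_eps[of t] unfolding mu_def[abs_def]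
  by (cases "t = 1") simp_all

lemma measurable_proposal_mean:
  assumes "t < T"
  shows "proposal_mean S t \<in> borel_measurable borel"
proof -
  have [measurable]: "mu S (t + 1) \<in> borel_measurable borel"
    using assms by (intro measurable_mu) auto
  have [measurable]: "grad (\<lambda>z. ln (pbar S (t + 1) z)) \<in> borel_measurable borel"
    using pbar_grad[of "t + 1"] assms by (intro borel_measurable_grad) (simp add: bounded_gradients_def)
  have [measurable]: "grad (\<lambda>m. ln (q_of_mean S t m)) \<in> borel_measurable borel"
    using q_grad[OF assms] by (intro borel_measurable_grad) (simp add: bounded_gradients_def)
  show ?thesis
    unfolding proposal_mean_def[abs_def] by measurable
qed

lemma measurable_transition:
  assumes "t < T" "f \<in> borel_measurable M" "g \<in> borel_measurable M"
  shows "(\<lambda>w. transition S t (f w) (g w)) \<in> borel_measurable M"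
proof -
  have "mu S (t + 1) \<in> borel_measurable borel"
    using assms(1) by (intro measurable_mu) auto
  then show ?thesis
    using assms(2,3) unfolding transition_def by measurable
qed

lemma measurable_proposal:
  assumes "t < T" "f \<in> borel_measurable M" "g \<in> borel_measurable M"
  shows "(\<lambda>w. proposal S t (f w) (g w)) \<in> borel_measurable M"
  using measurable_proposal_mean[OF assms(1)] assms(2,3) unfolding proposal_def by measurable

lemma nn_integral_proposal: "t < T \<Longrightarrow> (\<integral>\<^sup>+z. ennreal (proposal S t z' z) \<partial>lborel) = 1"
  unfolding proposal_def by (intro nn_integral_gauss proposal_sd_pos) auto

section \<open>Upper bounds for the weights\<close>

lemma transition_le_proposal:
  assumes "t < T"
  shows "\<exists>C>0. \<forall>z' z. transition S t z' z \<le> C * proposal S t z' z"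
proof -
  have t: "t + 1 \<in> {1..T}"
    using assms by auto
  obtain D1 where D1: "\<And>z. norm (grad (\<lambda>z. ln (pbar S (t + 1) z)) z) \<le> D1"
    using pbar_grad[OF t] by (auto simp: bounded_gradients_def bounded_iff)
  obtain D2 where D2: "\<And>z. norm (grad (\<lambda>m. ln (q_of_mean S t m)) z) \<le> D2"
    using q_grad[OF assms] by (auto simp: bounded_gradients_def bounded_iff)
  \<comment> \<open>Length of the guidance term that separates \<open>proposal_mean\<close> from
    \<open>mu\<close>. As D1 and D2 bound the gradients everywhere, it is uniform in z'.\<close>
  let ?D = "\<bar>gam S t\<bar> * D1 + \<bar>lam S t\<bar> * D2"
  let ?s = "prior_sd S (t + 1)" and ?r = "proposal_sd S (t + 1)"
  let ?C = "(?r / ?s * exp (?D\<^sup>2 / (2 * (?r\<^sup>2 - ?s\<^sup>2)))) ^ DIM('z)"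
  have "norm (mu S (t + 1) z' - proposal_mean S t z') \<le> ?D" for z'
    unfolding proposal_mean_def diff_diff_eq2 add_diff_cancel_left'
    using D1 D2 by (intro norm_triangle_le add_mono) (auto intro: mult_left_mono)
  then have "transition S t z' z \<le> ?C * proposal S t z' z" for z' z
    unfolding transition_def proposal_def
    by (intro gauss_le_wider prior_sd_pos proposal_sd_pos sd_less t)
  moreover have "0 < ?C"
    using prior_sd_pos[OF t] proposal_sd_pos[OF t] by simp
  ultimately show ?thesis
    by blast
qed

lemma weight_pos: "t \<le> T \<Longrightarrow> 0 < weight S t x"
  unfolding weight_def
  by (auto intro!: mult_pos_pos divide_pos_pos lik_pos pbar_pos transition_pos proposal_pos)

text \<open>Below the horizon the factors are regrouped into likelihood, ratio of lookahead
  densities, and transition over proposal, each of which is bounded.\<close>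

lemma weight_bounded:
  assumes "t \<le> T"
  shows "\<exists>C>0. \<forall>x. weight S t x \<le> C"
proof -
  obtain L where L: "\<And>z. lik S t z \<le> L"
    using positive_bounded_imp_le[OF lik_bounded[OF assms]] by blast
  have "0 < L"
    using L[of 0] lik_pos[of t 0] by linarith
  show ?thesis
  proof (cases "t = T")
    case True
    obtain P where P: "\<And>z. pbar S T z \<le> P"
      using positive_bounded_imp_le[OF pbar_last_bounded] by blast
    have "0 < P"
      using P[of 0] pbar_pos[of T 0] by simp
    have "weight S t x \<le> L * P" for x
      using True L[of "x T"] P[of "x T"] less_imp_le[OF lik_pos[of T "x T"]]
        less_imp_le[OF pbar_pos[of T "x T"]] \<open>0 < L\<close>
      by (simp add: weight_def mult_mono)
    then show ?thesis
      using \<open>0 < L\<close> \<open>0 < P\<close> by (intro exI[of _ "L * P"]) simp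
  next
    case False
    then have "t < T"
      using assms by simp
    obtain P where P: "\<And>z z'. pbar S t z / pbar S (t + 1) z' \<le> P"
      using positive_bounded_imp_le[OF pbar_ratio_bounded[OF \<open>t < T\<close>]] by auto
    have "0 < pbar S t 0 / pbar S (t + 1) 0"
      using \<open>t < T\<close> by (intro divide_pos_pos pbar_pos) auto
    then have "0 < P"
      using P[of 0 0] by linarith
    obtain C where "0 < C" and C: "\<And>z' z. transition S t z' z \<le> C * proposal S t z' z"
      using transition_le_proposal[OF \<open>t < T\<close>] by blast
    have quotient: "0 \<le> transition S t z' z / proposal S t z' z \<and> transition S t z' z / proposal S t z' z \<le> C" for z' z
      using C[of z' z] transition_pos[OF \<open>t < T\<close>, of z' z] proposal_pos[OF \<open>t < T\<close>, of z' z]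
      by (simp add: pos_divide_le_eq)
    have ratio: "0 \<le> pbar S t z / pbar S (t + 1) z'" for z z'
      using \<open>t < T\<close> by (intro divide_nonneg_nonneg less_imp_le[OF pbar_pos]) auto
    \<comment> \<open>Two bounds, because at time 0 the likelihood is itself
      \<open>pbar S 0\<close>: it forms the numerator of the ratio and leaves no further factor
      L.\<close>
    have "weight S t x \<le> max (L * P * C) (P * C)" for x
    proof (cases "t = 0")
      case True
      then have "weight S t x = pbar S 0 (x 0) / pbar S (0 + 1) (x 1)
          * (transition S 0 (x 1) (x 0) / proposal S 0 (x 1) (x 0))"
        using \<open>t < T\<close> by (simp add: weight_def pbar_def)
      also have "\<dots> \<le> P * C"
        using True P quotient ratio \<open>0 < P\<close> by (intro mult_mono) auto
      finally show ?thesis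
        by simp
    next
      case False
      then have "weight S t x = lik S t (x t) * (pbar S t (x t) / pbar S (t + 1) (x (t + 1)))
          * (transition S t (x (t + 1)) (x t) / proposal S t (x (t + 1)) (x t))"
        using \<open>t < T\<close> by (simp add: weight_def)
      also have "\<dots> \<le> L * P * C"
        using L P quotient ratio lik_pos[of t] \<open>0 < P\<close> \<open>0 < L\<close>
        by (intro mult_mono mult_nonneg_nonneg) (auto intro: less_imp_le)
      finally show ?thesis
        by simp
    qed
    then show ?thesis
      using \<open>0 < P\<close> \<open>0 < C\<close> by (intro exI[of _ "max (L * P * C) (P * C)"]) (auto simp: max_def)
  qed
qed

lemma measurable_coordinate: "s \<in> {t..T} \<Longrightarrow> (\<lambda>x. x s) \<in> path_space S t \<rightarrow>\<^sub>M borel"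
  unfolding path_space_def by (rule measurable_component_singleton)

text \<open>Stated on the longer paths starting at t, since the path density at time t multiplies
  the weights of all later times s.\<close>

lemma measurable_weight:
  assumes "t \<le> s" "s \<le> T"
  shows "weight S s \<in> borel_measurable (path_space S t)"
proof -
  have coord [measurable]: "(\<lambda>x. x s) \<in> path_space S t \<rightarrow>\<^sub>M borel"
    using assms by (intro measurable_coordinate) auto
  note [measurable] = measurable_pbar[OF assms(2)]
  show ?thesis
  proof (cases "s = T")
    case True
    have "(\<lambda>x. lik S s (x s) * pbar S s (x s)) \<in> borel_measurable (path_space S t)"
      by measurable
    then show ?thesis
      using True by (simp add: weight_def[abs_def])
  next
    case False
    then have s: "s < T" "s + 1 \<le> T"
      using assms by auto
    have next_coord [measurable]: "(\<lambda>x. x (s + 1)) \<in> path_space S t \<rightarrow>\<^sub>M borel"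
      using assms s by (intro measurable_coordinate) auto
    note [measurable] = measurable_pbar[OF s(2)] measurable_transition[OF s(1) next_coord coord]
      measurable_proposal[OF s(1) next_coord coord]
    have "(\<lambda>x. lik S s (x s) * transition S s (x (s + 1)) (x s)
          / (pbar S (s + 1) (x (s + 1)) * proposal S s (x (s + 1)) (x s))) \<in> borel_measurable (path_space S t)"
      "(\<lambda>x. lik S s (x s) * pbar S s (x s) * transition S s (x (s + 1)) (x s)
          / (pbar S (s + 1) (x (s + 1)) * proposal S s (x (s + 1)) (x s))) \<in> borel_measurable (path_space S t)"
      by measurable
    then show ?thesis
      using False by (cases "s = 0") (simp_all add: weight_def[abs_def])
  qed
qed

section \<open>Resampling and propagation\<close>

definition weighted_mean :: "nat \<Rightarrow> ((nat \<Rightarrow> 'z) \<Rightarrow> real) \<Rightarrow> nat \<Rightarrow> (nat \<Rightarrow> nat \<Rightarrow> 'z) \<Rightarrow> real" where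
  "weighted_mean t h N x = (\<Sum>i<N. norm_weight S N t x i * h (x i))"

lemma weighted_mean_eq:
  assumes "0 < N"
  shows "weighted_mean t h N x
    = empirical_mean (\<lambda>z. weight S t z * h z) N x / empirical_mean (weight S t) N x"
  using assms by (simp add: weighted_mean_def norm_weight_def empirical_mean_def sum_divide_distrib[symmetric])

lemma measurable_particle: "i < N \<Longrightarrow> (\<lambda>x. x i) \<in> config_space S N t \<rightarrow>\<^sub>M path_space S t"
  unfolding config_space_def by (rule measurable_component_singleton) simp

lemma measurable_of_particle:
  assumes "h \<in> borel_measurable (path_space S t)" "i < N"
  shows "(\<lambda>x. h (x i)) \<in> borel_measurable (config_space S N t)"
  using measurable_compose[OF measurable_particle[OF assms(2)] assms(1)] .

lemma measurable_empirical_mean: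
  assumes "h \<in> borel_measurable (path_space S t)"
  shows "empirical_mean h N \<in> borel_measurable (config_space S N t)"
  unfolding empirical_mean_def[abs_def]
  by (intro borel_measurable_divide borel_measurable_sum measurable_of_particle[OF assms]) auto

lemma norm_weight_nonneg: "t \<le> T \<Longrightarrow> 0 \<le> norm_weight S N t x i"
  unfolding norm_weight_def by (intro divide_nonneg_nonneg sum_nonneg less_imp_le[OF weight_pos])

lemma sum_norm_weight:
  assumes "t \<le> T" "0 < N"
  shows "(\<Sum>i<N. norm_weight S N t x i) = 1"
proof -
  have "0 < (\<Sum>j<N. weight S t (x j))"
    using assms by (intro sum_pos weight_pos) auto
  then show ?thesis
    by (simp add: norm_weight_def sum_divide_distrib[symmetric])
qed

lemma measurable_norm_weight:
  assumes "t \<le> T" "i < N"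
  shows "(\<lambda>x. norm_weight S N t x i) \<in> borel_measurable (config_space S N t)"
  unfolding norm_weight_def
  using assms by (intro borel_measurable_divide borel_measurable_sum measurable_of_particle measurable_weight) auto

lemma measurable_weighted_mean:
  assumes "t \<le> T" "h \<in> borel_measurable (path_space S t)"
  shows "weighted_mean t h N \<in> borel_measurable (config_space S N t)"
  unfolding weighted_mean_def[abs_def]
  using assms
  by (intro borel_measurable_sum borel_measurable_times measurable_norm_weight measurable_of_particle) auto

lemma bounded_measurable_weight: "t \<le> T \<Longrightarrow> bounded_measurable (path_space S t) (weight S t)"
  using weight_bounded[of t] measurable_weight[of t t] less_imp_le[OF weight_pos[of t]]
  unfolding bounded_measurable_def by (auto simp: abs_of_nonneg)

abbreviation ancestor_law :: "nat \<Rightarrow> nat \<Rightarrow> (nat \<Rightarrow> nat \<Rightarrow> 'z) \<Rightarrow> nat measure" where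
  "ancestor_law N t x \<equiv> point_measure {..<N} (\<lambda>j. ennreal (norm_weight S N t x j))"

abbreviation proposal_law :: "nat \<Rightarrow> 'z \<Rightarrow> 'z measure" where
  "proposal_law t z' \<equiv> density lborel (\<lambda>z. ennreal (proposal S t z' z))"

section \<open>The random draws as measurable kernels\<close>

lemma ancestor_law_measurable:
  assumes "t \<le> T" "0 < N"
  shows "ancestor_law N t \<in> config_space S N t \<rightarrow>\<^sub>M prob_algebra (count_space {..<N})"
  unfolding point_measure_def
proof (rule measurable_density_prob_algebra)
  show "sigma_finite_measure (count_space {..<N})"
    by (rule sigma_finite_measure_count_space_finite) simp
  \<comment> \<open>The index j ranges over a finite discrete space, so measurability in x for each
    fixed j is enough.\<close>
  show "(\<lambda>(x, j). ennreal (norm_weight S N t x j)) \<in> borel_measurable (config_space S N t \<Otimes>\<^sub>M count_space {..<N})"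
    unfolding case_prod_beta
    by (rule measurable_compose_countable'[where I = "{..<N}" and g = snd and f = "\<lambda>j p. ennreal (norm_weight S N t (fst p) j)"])
       (auto intro!: measurable_compose[OF measurable_fst] measurable_norm_weight assms
             measurable_compose[OF _ measurable_ennreal])
  show "(\<integral>\<^sup>+j. ennreal (norm_weight S N t x j) \<partial>count_space {..<N}) = 1" for x
    using assms by (simp add: nn_integral_count_space_finite sum_ennreal norm_weight_nonneg sum_norm_weight)
qed

lemma proposal_law_measurable:
  assumes "t < T"
  shows "proposal_law t \<in> borel \<rightarrow>\<^sub>M prob_algebra lborel"
proof (rule measurable_density_prob_algebra[OF sigma_finite_lborel])
  have "(\<lambda>p. proposal S t (fst p) (snd p)) \<in> borel_measurable (borel \<Otimes>\<^sub>M lborel)"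
    by (rule measurable_proposal[OF assms]) auto
  then show "(\<lambda>(z', z). ennreal (proposal S t z' z)) \<in> borel_measurable (borel \<Otimes>\<^sub>M lborel)"
    by (simp add: case_prod_beta)
qed (rule nn_integral_proposal[OF assms])

text \<open>Evaluation at a random index is measurable because the index takes countably many
  values.\<close>

lemma measurable_select:
  "(\<lambda>(x, a). \<lambda>i\<in>{..<N}. x (a i))
    \<in> config_space S N t \<Otimes>\<^sub>M (\<Pi>\<^sub>M i\<in>{..<N}. count_space {..<N}) \<rightarrow>\<^sub>M config_space S N t"
proof -
  have "(\<lambda>p. \<lambda>i\<in>{..<N}. fst p (snd p i)) \<in> config_space S N t \<Otimes>\<^sub>M (\<Pi>\<^sub>M i\<in>{..<N}. count_space {..<N})
      \<rightarrow>\<^sub>M (\<Pi>\<^sub>M i\<in>{..<N}. path_space S t)"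
  proof (rule measurable_restrict)
    fix i assume "i \<in> {..<N}"
    then show "(\<lambda>p. fst p (snd p i)) \<in> config_space S N t \<Otimes>\<^sub>M (\<Pi>\<^sub>M i\<in>{..<N}. count_space {..<N}) \<rightarrow>\<^sub>M path_space S t"
      by (intro measurable_compose_countable'[where I = "{..<N}" and g = "\<lambda>p. snd p i" and f = "\<lambda>j p. fst p j"])
         (auto intro!: measurable_compose[OF measurable_fst] measurable_particle
            measurable_compose[OF measurable_snd measurable_component_singleton])
  qed
  then show ?thesis
    unfolding config_space_def case_prod_beta .
qed

lemma insert_time: "t < T \<Longrightarrow> insert t {t + 1..T} = {t..T}"
  by auto

lemma measurable_extend:
  assumes "t < T"
  shows "(\<lambda>p. (fst p)(t := snd p)) \<in> path_space S (t + 1) \<Otimes>\<^sub>M borel \<rightarrow>\<^sub>M path_space S t"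
  using measurable_add_dim[of t "{t + 1..T}" "\<lambda>_. borel :: 'z measure"]
  unfolding path_space_def insert_time[OF assms] case_prod_beta .

lemma measurable_extend_config:
  assumes "t < T"
  shows "(\<lambda>(x, z). \<lambda>i\<in>{..<N}. (x i)(t := z i))
    \<in> config_space S N (t + 1) \<Otimes>\<^sub>M (\<Pi>\<^sub>M i\<in>{..<N}. lborel) \<rightarrow>\<^sub>M config_space S N t"
proof -
  have "(\<lambda>p. \<lambda>i\<in>{..<N}. (fst p i)(t := snd p i))
      \<in> config_space S N (t + 1) \<Otimes>\<^sub>M (\<Pi>\<^sub>M i\<in>{..<N}. lborel) \<rightarrow>\<^sub>M (\<Pi>\<^sub>M i\<in>{..<N}. path_space S t)"
  proof (rule measurable_restrict)
    fix i assume i: "i \<in> {..<N}"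
    have "(\<lambda>p. (fst p i, snd p i)) \<in> config_space S N (t + 1) \<Otimes>\<^sub>M (\<Pi>\<^sub>M i\<in>{..<N}. lborel :: 'z measure)
        \<rightarrow>\<^sub>M path_space S (t + 1) \<Otimes>\<^sub>M borel"
      using i measurable_component_singleton[OF i, of "\<lambda>_. lborel :: 'z measure"]
      by (intro measurable_Pair measurable_compose[OF measurable_fst measurable_particle]
          measurable_compose[OF measurable_snd]) auto
    from measurable_compose[OF this measurable_extend[OF assms]]
    show "(\<lambda>p. (fst p i)(t := snd p i))
        \<in> config_space S N (t + 1) \<Otimes>\<^sub>M (\<Pi>\<^sub>M i\<in>{..<N}. lborel) \<rightarrow>\<^sub>M path_space S t"
      by simp
  qed
  then show ?thesis
    unfolding config_space_def case_prod_beta .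
qed

lemma measurable_resample:
  assumes "t \<le> T" "0 < N"
  shows "resample S N t \<in> config_space S N t \<rightarrow>\<^sub>M prob_algebra (config_space S N t)"
  unfolding resample_def[abs_def]
  by (rule measurable_distr_prob_space2[OF measurable_PiM_prob_algebra measurable_select])
     (auto intro: ancestor_law_measurable[OF assms])

lemma measurable_propagate:
  assumes "t < T"
  shows "propagate S N t \<in> config_space S N (t + 1) \<rightarrow>\<^sub>M prob_algebra (config_space S N t)"
  unfolding propagate_def[abs_def]
proof (rule measurable_distr_prob_space2[OF measurable_PiM_prob_algebra measurable_extend_config[OF assms]])
  fix i assume "i \<in> {..<N}"
  then have "(\<lambda>x. x i (t + 1)) \<in> config_space S N (t + 1) \<rightarrow>\<^sub>M borel"
    using assms
    by (intro measurable_compose[OF measurable_particle measurable_coordinate]) auto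
  from measurable_compose[OF this proposal_law_measurable[OF assms]]
  show "(\<lambda>x. proposal_law t (x i (t + 1))) \<in> config_space S N (t + 1) \<rightarrow>\<^sub>M prob_algebra lborel" .
qed simp

section \<open>Conditional concentration of the two steps\<close>

lemma resample_tail:
  assumes "t \<le> T" "0 < N" "0 < \<epsilon>" and x: "x \<in> space (config_space S N t)"
    and h: "h \<in> borel_measurable (path_space S t)"
    and "0 < B" and bound: "\<And>z. z \<in> space (path_space S t) \<Longrightarrow> \<bar>h z\<bar> \<le> B"
  shows "measure (resample S N t x) {y \<in> space (config_space S N t).
      \<epsilon> \<le> \<bar>empirical_mean h N y - weighted_mean t h N x\<bar>} \<le> 2 * exp (- (1 / (2 * B\<^sup>2) * \<epsilon>\<^sup>2) * real N)"
proof -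
  let ?Q = "\<lambda>i::nat. ancestor_law N t x"
  have path: "x j \<in> space (path_space S t)" if "j < N" for j
    using measurable_space[OF measurable_particle x] that by simp
  have Q: "prob_space (ancestor_law N t x)"
    using measurable_space[OF ancestor_law_measurable x] assms by (auto simp: space_prob_algebra)
  have sets: "sets (Pi\<^sub>M {..<N} ?Q) = sets (\<Pi>\<^sub>M i\<in>{..<N}. count_space {..<N})"
    by (intro sets_PiM_cong) (auto simp: sets_point_measure)
  have \<phi>: "(\<lambda>a. \<lambda>i\<in>{..<N}. x (a i)) \<in> Pi\<^sub>M {..<N} ?Q \<rightarrow>\<^sub>M (\<Pi>\<^sub>M i\<in>{..<N}. path_space S t)"
    using measurable_Pair2[OF measurable_select x]
    unfolding measurable_cong_sets[OF sets refl] config_space_def prod.case .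
  \<comment> \<open>All ancestors have the same law, so the average of their N equal means is one of
    them: the sum of \<open>h (x j)\<close> against the normalized weights.\<close>
  have mean: "(\<Sum>i<N. integral\<^sup>L (?Q i) (\<lambda>j. h (x j))) / real N = weighted_mean t h N x"
    using assms
    by (simp add: lebesgue_integral_point_measure_finite norm_weight_nonneg weighted_mean_def)
  show ?thesis
    unfolding resample_def config_space_def empirical_mean_def mean[symmetric]
  proof (rule Hoeffding_distr_PiM[OF _ _ _ _ _ _ \<phi>])
    show "\<bar>h (x j)\<bar> \<le> B" if "j \<in> space (ancestor_law N t x)" for j
      using bound path that by (simp add: space_point_measure)
    show "h ((\<lambda>i\<in>{..<N}. x (a i)) i) = h (x (a i))" if "i < N" for i and a :: "nat \<Rightarrow> nat"
      using that by simp
    show "(\<lambda>j. h (x j)) \<in> borel_measurable (ancestor_law N t x)"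
      by simp
  qed (use assms Q in auto)
qed

text \<open>The proposal kernel acting on functions of the extended path. The density stands in the
  integrand, the shape that Fubini produces in \<open>path_integral_step\<close>;
  \<open>predict_eq_integral\<close> gives the measure form that Hoeffding needs.\<close>

definition predict :: "nat \<Rightarrow> ((nat \<Rightarrow> 'z) \<Rightarrow> real) \<Rightarrow> (nat \<Rightarrow> 'z) \<Rightarrow> real" where
  "predict t h x = (\<integral>z. proposal S t (x (t + 1)) z * h (x(t := z)) \<partial>lborel)"

lemma measurable_extend_path:
  assumes "t < T" "x \<in> space (path_space S (t + 1))"
  shows "(\<lambda>z. x(t := z)) \<in> borel \<rightarrow>\<^sub>M path_space S t"
  using measurable_compose[OF measurable_Pair1'[OF assms(2)] measurable_extend[OF assms(1)]] by simp

lemma predict_eq_integral: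
  assumes "t < T" "x \<in> space (path_space S (t + 1))" "h \<in> borel_measurable (path_space S t)"
  shows "predict t h x = (\<integral>z. h (x(t := z)) \<partial>proposal_law t (x (t + 1)))"
  unfolding predict_def
  using measurable_compose[OF measurable_extend_path[OF assms(1,2)] assms(3)]
    measurable_proposal[OF assms(1), of "\<lambda>_. x (t + 1)" lborel "\<lambda>z. z"] proposal_pos[OF assms(1)]
  by (subst integral_density) (auto intro: less_imp_le)

lemma prob_space_proposal_law: "t < T \<Longrightarrow> prob_space (proposal_law t z')"
  using measurable_space[OF proposal_law_measurable, of t z'] by (auto simp: space_prob_algebra)

text \<open>Averaging against a probability measure preserves the bound, and a parametrized integral
  is measurable. This keeps the induction within the class of test functions.\<close>

lemma bounded_measurable_predict:
  assumes "t < T" "bounded_measurable (path_space S t) h"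
  shows "bounded_measurable (path_space S (t + 1)) (predict t h)"
proof -
  obtain B where "0 < B" and B: "\<And>x. x \<in> space (path_space S t) \<Longrightarrow> \<bar>h x\<bar> \<le> B"
    and h: "h \<in> borel_measurable (path_space S t)"
    using assms(2) unfolding bounded_measurable_def by blast
  have "\<bar>predict t h x\<bar> \<le> B" if x: "x \<in> space (path_space S (t + 1))" for x
  proof -
    interpret prob_space "proposal_law t (x (t + 1))"
      by (rule prob_space_proposal_law[OF assms(1)])
    have path: "x(t := z) \<in> space (path_space S t)" for z
      using measurable_space[OF measurable_extend_path[OF assms(1) x]] by simp
    have "(\<lambda>z. h (x(t := z))) \<in> borel_measurable (proposal_law t (x (t + 1)))"
      using measurable_compose[OF measurable_extend_path[OF assms(1) x] h] by simp
    then have int: "integrable (proposal_law t (x (t + 1))) (\<lambda>z. h (x(t := z)))"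
      using B[OF path] by (intro integrable_const_bound[where B = B]) auto
    have "\<bar>predict t h x\<bar> \<le> (\<integral>z. \<bar>h (x(t := z))\<bar> \<partial>proposal_law t (x (t + 1)))"
      using predict_eq_integral[OF assms(1) x h] by simp
    also have "\<dots> \<le> B"
      using int B[OF path] by (intro integral_le_const) auto
    finally show ?thesis .
  qed
  moreover have "predict t h \<in> borel_measurable (path_space S (t + 1))"
  proof -
    have coord: "(\<lambda>p. fst p (t + 1)) \<in> borel_measurable (path_space S (t + 1) \<Otimes>\<^sub>M lborel)"
      using assms(1) by (intro measurable_compose[OF measurable_fst measurable_coordinate]) auto
    have sets: "sets (path_space S (t + 1) \<Otimes>\<^sub>M lborel) = sets (path_space S (t + 1) \<Otimes>\<^sub>M (borel :: 'z measure))"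
      by (intro sets_pair_measure_cong) auto
    have "(\<lambda>p. h ((fst p)(t := snd p))) \<in> borel_measurable (path_space S (t + 1) \<Otimes>\<^sub>M lborel)"
      using measurable_compose[OF measurable_extend[OF assms(1)] h]
      unfolding measurable_cong_sets[OF sets refl] .
    then show ?thesis
      unfolding predict_def[abs_def]
      using measurable_proposal[OF assms(1) coord, of snd]
      by (intro lborel.borel_measurable_lebesgue_integral) (simp add: case_prod_beta)
  qed
  ultimately show ?thesis
    using \<open>0 < B\<close> unfolding bounded_measurable_def by blast
qed

lemma propagate_tail:
  assumes "t < T" "0 < N" "0 < \<epsilon>" and x: "x \<in> space (config_space S N (t + 1))"
    and h: "h \<in> borel_measurable (path_space S t)"
    and "0 < B" and bound: "\<And>z. z \<in> space (path_space S t) \<Longrightarrow> \<bar>h z\<bar> \<le> B"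
  shows "measure (propagate S N t x) {y \<in> space (config_space S N t).
      \<epsilon> \<le> \<bar>empirical_mean h N y - empirical_mean (predict t h) N x\<bar>}
    \<le> 2 * exp (- (1 / (2 * B\<^sup>2) * \<epsilon>\<^sup>2) * real N)"
proof -
  let ?Q = "\<lambda>i::nat. proposal_law t (x i (t + 1))"
  have path: "x i \<in> space (path_space S (t + 1))" if "i < N" for i
    using measurable_space[OF measurable_particle x] that by simp
  have ext: "(\<lambda>z. (x i)(t := z)) \<in> borel \<rightarrow>\<^sub>M path_space S t" if "i < N" for i
    by (rule measurable_extend_path[OF assms(1) path[OF that]])
  have sets: "sets (Pi\<^sub>M {..<N} ?Q) = sets (\<Pi>\<^sub>M i\<in>{..<N}. lborel)"
    by (intro sets_PiM_cong) auto
  have \<phi>: "(\<lambda>z. \<lambda>i\<in>{..<N}. (x i)(t := z i)) \<in> Pi\<^sub>M {..<N} ?Q \<rightarrow>\<^sub>M (\<Pi>\<^sub>M i\<in>{..<N}. path_space S t)"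
    using measurable_Pair2[OF measurable_extend_config[OF assms(1)] x]
    unfolding measurable_cong_sets[OF sets refl] config_space_def prod.case .
  \<comment> \<open>Each particle has its own proposal law, so the centring is the average of N
    different conditional means, again an empirical mean over the old configuration.\<close>
  have mean: "(\<Sum>i<N. integral\<^sup>L (?Q i) (\<lambda>z. h ((x i)(t := z)))) / real N
      = (\<Sum>i<N. predict t h (x i)) / real N"
    using predict_eq_integral[OF assms(1) path h] by simp
  show ?thesis
    unfolding propagate_def config_space_def empirical_mean_def mean[symmetric]
  proof (rule Hoeffding_distr_PiM[OF _ _ _ _ _ _ \<phi>])
    show "\<bar>h ((x i)(t := z))\<bar> \<le> B" if "i < N" for i z
      using bound measurable_space[OF ext[OF that]] by simp
    show "(\<lambda>z. h ((x i)(t := z))) \<in> borel_measurable (?Q i)" if "i < N" for i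
      using measurable_compose[OF ext[OF that] h] by simp
    show "h ((\<lambda>i\<in>{..<N}. (x i)(t := z i)) i) = h ((x i)(t := z i))" if "i < N" for i and z :: "nat \<Rightarrow> 'z"
      using that by simp
  qed (use assms prob_space_proposal_law in auto)
qed

section \<open>The limiting path measure\<close>

text \<open>The unnormalized Feynman-Kac density that the weighted particles target at time t. For t
  > 0 it still carries the lookahead factor \<open>pbar S t\<close>, which disappears at time
  0.\<close>

definition path_density :: "nat \<Rightarrow> (nat \<Rightarrow> 'z) \<Rightarrow> real" where
  "path_density t x = gauss 0 1 (x T) * (\<Prod>s\<in>{t..<T}. proposal S s (x (s + 1)) (x s))
     * (\<Prod>s\<in>{t..T}. weight S s x)"

abbreviation path_lborel :: "nat \<Rightarrow> (nat \<Rightarrow> 'z) measure" where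
  "path_lborel t \<equiv> \<Pi>\<^sub>M s\<in>{t..T}. lborel"

definition path_integral :: "nat \<Rightarrow> ((nat \<Rightarrow> 'z) \<Rightarrow> real) \<Rightarrow> real" where
  "path_integral t f = (\<integral>x. f x * path_density t x \<partial>path_lborel t)"

lemma sets_path_lborel: "sets (path_lborel t) = sets (path_space S t)"
  unfolding path_space_def by (intro sets_PiM_cong) auto

lemma space_path_lborel: "space (path_lborel t) = space (path_space S t)"
  by (rule sets_eq_imp_space_eq[OF sets_path_lborel])

lemma path_density_pos: "0 < path_density t x"
  unfolding path_density_def
  by (intro mult_pos_pos prod_pos ballI gauss_pos proposal_pos weight_pos) auto

lemma measurable_path_density:
  assumes "t \<le> T"
  shows "path_density t \<in> borel_measurable (path_space S t)"
proof -
  have "(\<lambda>x. x T) \<in> path_space S t \<rightarrow>\<^sub>M borel"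
    using assms by (intro measurable_coordinate) auto
  then have prior: "(\<lambda>x. gauss 0 1 (x T)) \<in> borel_measurable (path_space S t)"
    by (intro measurable_gauss) simp
  have proposals: "(\<lambda>x. proposal S s (x (s + 1)) (x s)) \<in> borel_measurable (path_space S t)" if "s \<in> {t..<T}" for s
    using that by (intro measurable_proposal measurable_coordinate) auto
  have weights: "(\<lambda>x. weight S s x) \<in> borel_measurable (path_space S t)" if "s \<in> {t..T}" for s
    using that by (intro measurable_weight) auto
  show ?thesis
    unfolding path_density_def
    by (intro borel_measurable_times borel_measurable_prod prior proposals weights)
qed

lemma path_density_last: "path_density T x = gauss 0 1 (x T) * weight S T x"
  by (simp add: path_density_def)

lemma path_density_step:
  assumes "t < T"
  shows "path_density t x = path_density (t + 1) x * proposal S t (x (t + 1)) (x t) * weight S t x"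
  using assms
  by (simp add: path_density_def prod.atLeast_Suc_lessThan[of t T] prod.atLeast_Suc_atMost[of t T])

text \<open>Factors belonging to times after t never read coordinate t, so overwriting it changes
  only the newest proposal and weight.\<close>

lemma path_density_extend:
  assumes "t < T"
  shows "path_density t (x(t := z))
    = path_density (t + 1) x * proposal S t (x (t + 1)) z * weight S t (x(t := z))"
proof -
  have "weight S s (x(t := z)) = weight S s x" if "t < s" for s
    using that by (simp add: weight_def)
  then have "path_density (t + 1) (x(t := z)) = path_density (t + 1) x"
    using assms unfolding path_density_def by (intro arg_cong2[where f = "(*)"] prod.cong) auto
  then show ?thesis
    using path_density_step[OF assms, of "x(t := z)"] by simp
qed

lemma singleton_path:
  assumes "x \<in> space (path_space S T)"
  shows "(\<lambda>s\<in>{T}. x T) = x"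
  using assms by (auto simp: path_space_def space_PiM PiE_def extensional_def fun_eq_iff)

interpretation lborel: product_sigma_finite "\<lambda>_ :: nat. lborel :: 'z measure"
  by standard

lemma measurable_singleton_path: "(\<lambda>z. \<lambda>s\<in>{T}. z) \<in> borel \<rightarrow>\<^sub>M path_space S T"
  unfolding path_space_def by (simp add: measurable_restrict)

text \<open>Downwards in t: integrating out the newest coordinate against a proposal of mass 1
  multiplies the total by at most the bound of the weight. Nonnegative integrals are used because
  integrability is only a consequence.\<close>

lemma nn_integral_path_density:
  assumes "t \<le> T"
  shows "(\<integral>\<^sup>+x. ennreal (path_density t x) \<partial>path_lborel t) < \<infinity>"
  using assms
proof (induction rule: inc_induct)
  case base
  obtain C where "0 < C" and C: "\<And>x. weight S T x \<le> C"
    using weight_bounded[of T] by auto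
  have "(\<integral>\<^sup>+x. ennreal (path_density T x) \<partial>path_lborel T)
      \<le> (\<integral>\<^sup>+x. ennreal C * ennreal (gauss 0 1 (x T)) \<partial>path_lborel T)"
    using C \<open>0 < C\<close> unfolding path_density_last
    by (intro nn_integral_mono)
       (simp add: ennreal_mult'[symmetric] mult.commute[of C] mult_left_mono ennreal_leI)
  also have "\<dots> = (\<integral>\<^sup>+z. ennreal C * ennreal (gauss 0 1 (z :: 'z)) \<partial>lborel)"
    using lborel.product_nn_integral_singleton[of "\<lambda>z. ennreal C * ennreal (gauss 0 1 z)" T] by simp
  also have "\<dots> < \<infinity>"
    by (simp add: nn_integral_cmult nn_integral_gauss)
  finally show ?case .
next
  case (step t)
  obtain C where "0 < C" and C: "\<And>x. weight S t x \<le> C"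
    using weight_bounded[of t] step.hyps by auto
  have meas: "(\<lambda>x. ennreal (path_density t x)) \<in> borel_measurable (Pi\<^sub>M (insert t {t + 1..T}) (\<lambda>_. lborel))"
    using measurable_path_density[of t] step.hyps
    unfolding insert_time[OF step.hyps(2)] measurable_cong_sets[OF sets_path_lborel refl] by simp
  have "(\<integral>\<^sup>+x. ennreal (path_density t x) \<partial>path_lborel t)
      = (\<integral>\<^sup>+x. \<integral>\<^sup>+z. ennreal (path_density t (x(t := z))) \<partial>lborel \<partial>path_lborel (t + 1))"
    using lborel.product_nn_integral_insert[OF _ _ meas] unfolding insert_time[OF step.hyps(2)] by simp
  also have "\<dots> \<le> (\<integral>\<^sup>+x. ennreal C * ennreal (path_density (t + 1) x) \<partial>path_lborel (t + 1))"
  proof (rule nn_integral_mono)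
    fix x :: "nat \<Rightarrow> 'z"
    have "(\<lambda>z. proposal S t (x (t + 1)) z) \<in> borel_measurable lborel"
      using step.hyps by (intro measurable_proposal) auto
    then have meas_proposal: "(\<lambda>z. ennreal (proposal S t (x (t + 1)) z)) \<in> borel_measurable lborel"
      by (rule measurable_compose) simp
    have "(\<integral>\<^sup>+z. ennreal (path_density t (x(t := z))) \<partial>lborel)
        \<le> (\<integral>\<^sup>+z. ennreal (C * path_density (t + 1) x) * ennreal (proposal S t (x (t + 1)) z) \<partial>lborel)"
    proof (rule nn_integral_mono)
      fix z
      have "path_density t (x(t := z)) \<le> path_density (t + 1) x * proposal S t (x (t + 1)) z * C"
        unfolding path_density_extend[OF step.hyps(2)] using step.hyps C
        by (intro mult_left_mono mult_nonneg_nonneg) (auto intro: less_imp_le path_density_pos proposal_pos)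
      also have "\<dots> = C * path_density (t + 1) x * proposal S t (x (t + 1)) z"
        by simp
      finally show "ennreal (path_density t (x(t := z)))
          \<le> ennreal (C * path_density (t + 1) x) * ennreal (proposal S t (x (t + 1)) z)"
        using \<open>0 < C\<close> path_density_pos[of "t + 1" x]
        by (simp add: ennreal_mult'[symmetric] ennreal_leI)
    qed
    also have "\<dots> = ennreal (C * path_density (t + 1) x)"
      by (simp only: nn_integral_cmult[OF meas_proposal] nn_integral_proposal[OF step.hyps(2)] mult_1_right)
    finally show "(\<integral>\<^sup>+z. ennreal (path_density t (x(t := z))) \<partial>lborel)
        \<le> ennreal C * ennreal (path_density (t + 1) x)"
      using \<open>0 < C\<close> by (simp add: ennreal_mult')
  qed
  also have "\<dots> = ennreal C * (\<integral>\<^sup>+x. ennreal (path_density (t + 1) x) \<partial>path_lborel (t + 1))"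
    using measurable_path_density[of "t + 1"] step.hyps
    by (intro nn_integral_cmult) (unfold measurable_cong_sets[OF sets_path_lborel refl], simp)
  also have "\<dots> < \<infinity>"
    using step.IH by (simp add: ennreal_mult_less_top)
  finally show ?case .
qed

lemma integrable_path_density:
  assumes "t \<le> T" "bounded_measurable (path_space S t) f"
  shows "integrable (path_lborel t) (\<lambda>x. f x * path_density t x)"
proof -
  obtain B where "0 < B" and B: "\<And>x. x \<in> space (path_space S t) \<Longrightarrow> \<bar>f x\<bar> \<le> B"
    and f: "f \<in> borel_measurable (path_space S t)"
    using assms(2) unfolding bounded_measurable_def by blast
  have [measurable]: "path_density t \<in> borel_measurable (path_lborel t)" "f \<in> borel_measurable (path_lborel t)"
    using measurable_path_density[OF assms(1)] f
    unfolding measurable_cong_sets[OF sets_path_lborel refl] by simp_all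
  have "integrable (path_lborel t) (path_density t)"
    using nn_integral_path_density[OF assms(1)]
    by (intro integrableI_nonneg) (auto intro: less_imp_le path_density_pos)
  then have "integrable (path_lborel t) (\<lambda>x. B * path_density t x)"
    by simp
  then show ?thesis
  proof (rule Bochner_Integration.integrable_bound)
    show "AE x in path_lborel t. norm (f x * path_density t x) \<le> norm (B * path_density t x)"
      using B less_imp_le[OF path_density_pos[of t]] \<open>0 < B\<close>
      by (intro AE_I2) (simp add: abs_mult space_path_lborel mult_right_mono)
  qed measurable
qed

text \<open>If the integral of a strictly positive function vanished, the whole space would be null.
  This legitimizes every division by a limit of mean weights.\<close>

lemma path_integral_one_pos:
  assumes "t \<le> T"
  shows "0 < path_integral t (\<lambda>_. 1)"
proof -
  have int: "integrable (path_lborel t) (path_density t)"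
    using integrable_path_density[OF assms bounded_measurable_const[of _ 1]] by simp
  have "integral\<^sup>L (path_lborel t) (path_density t) \<noteq> 0"
  proof
    assume "integral\<^sup>L (path_lborel t) (path_density t) = 0"
    then have "AE x in path_lborel t. path_density t x = 0"
      using integral_nonneg_eq_0_iff_AE[OF int] less_imp_le[OF path_density_pos] by simp
    then have "AE x in path_lborel t. False"
      by (rule AE_mp) (use path_density_pos in \<open>auto intro!: AE_I2 simp: less_imp_neq[symmetric]\<close>)
    then have "emeasure (path_lborel t) (space (path_lborel t)) = 0"
      by (simp add: AE_iff_measurable[OF sets.top])
    \<comment> \<open>The measure of the whole space is a product of infinite factors, hence not
      0.\<close>
    moreover have "emeasure (path_lborel t) (space (path_lborel t)) = (\<Prod>s\<in>{t..T}. emeasure lborel (UNIV :: 'z set))"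
      unfolding space_PiM by (subst lborel.emeasure_PiM) auto
    ultimately show False
      by simp
  qed
  moreover have "0 \<le> integral\<^sup>L (path_lborel t) (path_density t)"
    by (intro Bochner_Integration.integral_nonneg less_imp_le[OF path_density_pos])
  ultimately show ?thesis
    by (simp add: path_integral_def)
qed

text \<open>The Feynman-Kac recursion: by Fubini the newest coordinate is integrated first, and its
  proposal and weight are exactly what \<open>predict\<close> integrates.\<close>

lemma path_integral_step:
  assumes "t < T" "bounded_measurable (path_space S t) f"
  shows "path_integral t f = path_integral (t + 1) (predict t (\<lambda>x. weight S t x * f x))"
proof -
  have int: "integrable (Pi\<^sub>M (insert t {t + 1..T}) (\<lambda>_. lborel)) (\<lambda>x. f x * path_density t x)"
    using integrable_path_density[OF _ assms(2)] assms(1) unfolding insert_time[OF assms(1)] by simp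
  have "path_integral t f
      = (\<integral>x. \<integral>z. f (x(t := z)) * path_density t (x(t := z)) \<partial>lborel \<partial>path_lborel (t + 1))"
    using lborel.product_integral_insert[OF _ _ int] unfolding path_integral_def insert_time[OF assms(1)] by simp
  also have "\<dots> = (\<integral>x. predict t (\<lambda>x. weight S t x * f x) x * path_density (t + 1) x \<partial>path_lborel (t + 1))"
  proof (rule Bochner_Integration.integral_cong[OF refl])
    fix x :: "nat \<Rightarrow> 'z"
    have "(\<integral>z. f (x(t := z)) * path_density t (x(t := z)) \<partial>lborel)
        = (\<integral>z. path_density (t + 1) x *
            (proposal S t (x (t + 1)) z * (weight S t (x(t := z)) * f (x(t := z)))) \<partial>lborel)"
      unfolding path_density_extend[OF assms(1)] by (simp add: mult_ac)
    then show "(\<integral>z. f (x(t := z)) * path_density t (x(t := z)) \<partial>lborel)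
        = predict t (\<lambda>x. weight S t x * f x) x * path_density (t + 1) x"
      by (simp add: predict_def mult.commute)
  qed
  finally show ?thesis
    by (simp add: path_integral_def)
qed

section \<open>Convergence of the particle system\<close>

definition init_mean :: "((nat \<Rightarrow> 'z) \<Rightarrow> real) \<Rightarrow> real" where
  "init_mean h = (\<integral>z. h (\<lambda>s\<in>{T}. z) \<partial>density lborel (\<lambda>z. ennreal (gauss 0 1 z)))"

lemma path_integral_last:
  assumes "f \<in> borel_measurable (path_space S T)"
  shows "path_integral T f = init_mean (\<lambda>x. weight S T x * f x)"
proof -
  have [measurable]: "(\<lambda>z. f (\<lambda>s\<in>{T}. z)) \<in> borel_measurable borel" "(\<lambda>z. weight S T (\<lambda>s\<in>{T}. z)) \<in> borel_measurable borel"
    using measurable_compose[OF measurable_singleton_path assms]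
      measurable_compose[OF measurable_singleton_path measurable_weight[of T T]] by simp_all
  have "path_integral T f = (\<integral>x. gauss 0 1 (x T) * (weight S T (\<lambda>s\<in>{T}. x T) * f (\<lambda>s\<in>{T}. x T)) \<partial>path_lborel T)"
    unfolding path_integral_def path_density_last
  proof (rule Bochner_Integration.integral_cong[OF refl])
    \<comment> \<open>A path of length one is determined by its only coordinate, but only within the
      space, where it is \<open>undefined\<close> elsewhere. This turns the integrand into a
      function of \<open>x T\<close>.\<close>
    fix x assume "x \<in> space (path_lborel T)"
    then have "(\<lambda>s\<in>{T}. x T) = x"
      unfolding space_path_lborel by (rule singleton_path)
    then show "f x * (gauss 0 1 (x T) * weight S T x)
        = gauss 0 1 (x T) * (weight S T (\<lambda>s\<in>{T}. x T) * f (\<lambda>s\<in>{T}. x T))"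
      by (simp only: mult_ac)
  qed
  also have "\<dots> = (\<integral>z. gauss 0 1 z * (weight S T (\<lambda>s\<in>{T}. z) * f (\<lambda>s\<in>{T}. z)) \<partial>lborel)"
    using lborel.product_integral_singleton[of "\<lambda>z. gauss 0 1 z * (weight S T (\<lambda>s\<in>{T}. z) * f (\<lambda>s\<in>{T}. z))" T]
    by simp
  also have "\<dots> = init_mean (\<lambda>x. weight S T x * f x)"
    unfolding init_mean_def by (subst integral_density) auto
  finally show ?thesis .
qed

lemma measurable_init:
  "(\<lambda>z. \<lambda>i\<in>{..<N}. \<lambda>s\<in>{T}. z i)
    \<in> (\<Pi>\<^sub>M i\<in>{..<N}. density lborel (\<lambda>z. ennreal (gauss 0 1 z))) \<rightarrow>\<^sub>M config_space S N T"
  unfolding config_space_def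
proof (rule measurable_restrict)
  fix i assume "i \<in> {..<N}"
  then have "(\<lambda>z. z i) \<in> (\<Pi>\<^sub>M i\<in>{..<N}. density lborel (\<lambda>z. ennreal (gauss 0 1 z))) \<rightarrow>\<^sub>M borel"
    using measurable_component_singleton[of i "{..<N}" "\<lambda>_. density lborel (\<lambda>z. ennreal (gauss 0 1 z))"] by simp
  from measurable_compose[OF this measurable_singleton_path]
  show "(\<lambda>z. \<lambda>s\<in>{T}. z i) \<in> (\<Pi>\<^sub>M i\<in>{..<N}. density lborel (\<lambda>z. ennreal (gauss 0 1 z))) \<rightarrow>\<^sub>M path_space S T" .
qed

lemma init_in_prob_algebra: "init S N \<in> space (prob_algebra (config_space S N T))"
  unfolding init_def
  by (auto simp: space_prob_algebra intro!: prob_space.prob_space_distr prob_space_PiM prob_space_gauss measurable_init)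

lemma smc_in_prob_algebra:
  "k \<le> T \<Longrightarrow> 0 < N \<Longrightarrow> smc S N k \<in> space (prob_algebra (config_space S N (T - k)))"
proof (induction k)
  case 0
  then show ?case
    by (simp add: init_in_prob_algebra)
next
  case (Suc k)
  have kernel: "(\<lambda>x. resample S N (T - k) x \<bind> propagate S N (T - Suc k))
      \<in> config_space S N (T - k) \<rightarrow>\<^sub>M prob_algebra (config_space S N (T - Suc k))"
    using Suc.prems measurable_propagate[of "T - Suc k" N] measurable_resample[of "T - k" N]
    by (intro measurable_bind_prob_space) (auto simp: Suc_diff_Suc)
  have "smc S N k \<in> space (prob_algebra (config_space S N (T - k)))"
    using Suc by simp
  from prob_space_bind'[OF this kernel] sets_bind'[OF this kernel]
  show ?case
    by (simp add: space_prob_algebra)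
qed

lemma init_mean_converges:
  assumes "bounded_measurable (path_space S T) h"
  shows "converges_completely (\<lambda>N. init S N) (empirical_mean h) (init_mean h)"
proof -
  obtain B where "0 < B" and B: "\<And>x. x \<in> space (path_space S T) \<Longrightarrow> \<bar>h x\<bar> \<le> B"
    and h: "h \<in> borel_measurable (path_space S T)"
    using assms unfolding bounded_measurable_def by blast
  let ?Q = "\<lambda>_::nat. density lborel (\<lambda>z::'z. ennreal (gauss 0 1 z))"
  show ?thesis
  proof (rule converges_completely_Hoeffding)
    show "0 < 1 / (2 * B\<^sup>2)"
      using \<open>0 < B\<close> by simp
    fix N :: nat and \<epsilon> :: real
    assume "0 < N" "0 < \<epsilon>"
    have mean: "(\<Sum>i<N. integral\<^sup>L (?Q i) (\<lambda>z. h (\<lambda>s\<in>{T}. z))) / real N = init_mean h"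
      using \<open>0 < N\<close> by (simp add: init_mean_def)
    have "measure (distr (Pi\<^sub>M {..<N} ?Q) (\<Pi>\<^sub>M i\<in>{..<N}. path_space S T) (\<lambda>z. \<lambda>i\<in>{..<N}. \<lambda>s\<in>{T}. z i))
        {y \<in> space (\<Pi>\<^sub>M i\<in>{..<N}. path_space S T). \<epsilon> \<le> \<bar>(\<Sum>i<N. h (y i)) / real N
          - (\<Sum>i<N. integral\<^sup>L (?Q i) (\<lambda>z. h (\<lambda>s\<in>{T}. z))) / real N\<bar>}
        \<le> 2 * exp (- (1 / (2 * B\<^sup>2) * \<epsilon>\<^sup>2) * real N)"
    proof (rule Hoeffding_distr_PiM)
      show "(\<lambda>z. \<lambda>i\<in>{..<N}. \<lambda>s\<in>{T}. z i) \<in> Pi\<^sub>M {..<N} ?Q \<rightarrow>\<^sub>M (\<Pi>\<^sub>M i\<in>{..<N}. path_space S T)"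
        using measurable_init unfolding config_space_def .
      show "\<bar>h (\<lambda>s\<in>{T}. z)\<bar> \<le> B" for z
        using B measurable_space[OF measurable_singleton_path] by simp
      show "(\<lambda>z. h (\<lambda>s\<in>{T}. z)) \<in> borel_measurable (?Q i)" for i
        using measurable_compose[OF measurable_singleton_path h] by simp
      show "h ((\<lambda>i\<in>{..<N}. \<lambda>s\<in>{T}. z i) i) = h (\<lambda>s\<in>{T}. z i)" if "i < N" for i and z :: "nat \<Rightarrow> 'z"
        using that by simp
    qed (use \<open>0 < N\<close> \<open>0 < \<epsilon>\<close> \<open>0 < B\<close> h in \<open>auto intro: prob_space_gauss\<close>)
    then show "measure (init S N) {y \<in> space (init S N). \<epsilon> \<le> \<bar>empirical_mean h N y - init_mean h\<bar>}
        \<le> 2 * exp (- (1 / (2 * B\<^sup>2) * \<epsilon>\<^sup>2) * real N)"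
      unfolding mean init_def config_space_def empirical_mean_def space_distr .
  qed
qed

text \<open>L stands for the limits of the unweighted means of all test functions, so the lemma
  serves the initial time, where L is \<open>init_mean\<close>, and every later step. Boundedness of
  the weight makes both \<open>weight S t\<close> and its product with f admissible
  arguments.\<close>

lemma weighted_mean_converges:
  assumes "t \<le> T" "bounded_measurable (path_space S t) f"
    and P: "\<And>N. 0 < N \<Longrightarrow> P N \<in> space (prob_algebra (config_space S N t))"
    and means: "\<And>h. bounded_measurable (path_space S t) h \<Longrightarrow> converges_completely P (empirical_mean h) (L h)"
    and "L (weight S t) \<noteq> 0"
  shows "converges_completely P (weighted_mean t f) (L (\<lambda>x. weight S t x * f x) / L (weight S t))"
proof -
  have wf: "bounded_measurable (path_space S t) (\<lambda>x. weight S t x * f x)"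
    using assms by (intro bounded_measurable_mult bounded_measurable_weight)
  have "converges_completely P
      (\<lambda>N x. empirical_mean (\<lambda>z. weight S t z * f z) N x / empirical_mean (weight S t) N x)
      (L (\<lambda>x. weight S t x * f x) / L (weight S t))"
    using assms wf bounded_measurable_weight[OF assms(1)]
    by (intro converges_completely_divide[where A = "\<lambda>N. config_space S N t"] means measurable_empirical_mean)
       (auto simp: bounded_measurable_def)
  then show ?thesis
    by (rule converges_completely_cong[THEN iffD1, rotated -1]) (simp_all add: weighted_mean_eq)
qed

text \<open>Two conditional centrings in succession: propagation centres the mean of h at that of
  \<open>predict t h\<close> over the resampled paths, and resampling centres the latter at the
  weighted mean before it.\<close>

lemma empirical_mean_step:
  assumes "t < T" "bounded_measurable (path_space S t) h"
    and P: "\<And>N. 0 < N \<Longrightarrow> P N \<in> space (prob_algebra (config_space S N (t + 1)))"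
    and weighted: "converges_completely P (weighted_mean (t + 1) (predict t h)) l"
  shows "converges_completely (\<lambda>N. P N \<bind> (\<lambda>x. resample S N (t + 1) x \<bind> propagate S N t)) (empirical_mean h) l"
proof -
  have t: "t + 1 \<le> T"
    using assms(1) by simp
  obtain B where "0 < B" and B: "\<And>x. x \<in> space (path_space S t) \<Longrightarrow> \<bar>h x\<bar> \<le> B"
    and h: "h \<in> borel_measurable (path_space S t)"
    using assms(2) unfolding bounded_measurable_def by blast
  obtain B' where "0 < B'" and B': "\<And>x. x \<in> space (path_space S (t + 1)) \<Longrightarrow> \<bar>predict t h x\<bar> \<le> B'"
    and ph: "predict t h \<in> borel_measurable (path_space S (t + 1))"
    using bounded_measurable_predict[OF assms(1,2)] unfolding bounded_measurable_def by blast
  note R = measurable_resample[OF t]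
  have resampled: "converges_completely (\<lambda>N. P N \<bind> resample S N (t + 1)) (empirical_mean (predict t h)) l"
    using \<open>0 < B'\<close>
    by (intro converges_completely_bind[where c = "1 / (2 * B'\<^sup>2)" and H = "weighted_mean (t + 1) (predict t h)" and A = "\<lambda>N. config_space S N (t + 1)"
          and B = "\<lambda>N. config_space S N (t + 1)"] P R measurable_empirical_mean[OF ph]
          measurable_weighted_mean[OF t ph] resample_tail[OF t _ _ _ ph] weighted B') auto
  have "P N \<bind> resample S N (t + 1) \<in> space (prob_algebra (config_space S N (t + 1)))" if "0 < N" for N
    using prob_space_bind'[OF P[OF that] R[OF that]] sets_bind'[OF P[OF that] R[OF that]]
    by (simp add: space_prob_algebra)
  then have "converges_completely (\<lambda>N. P N \<bind> resample S N (t + 1) \<bind> propagate S N t) (empirical_mean h) l"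
    using \<open>0 < B\<close>
    by (intro converges_completely_bind[where c = "1 / (2 * B\<^sup>2)" and H = "empirical_mean (predict t h)" and A = "\<lambda>N. config_space S N (t + 1)"
          and B = "\<lambda>N. config_space S N t"] measurable_propagate[OF assms(1)] measurable_empirical_mean[OF ph]
          measurable_empirical_mean[OF h] propagate_tail[OF assms(1) _ _ _ h] resampled B) auto
  \<comment> \<open>\<open>smc\<close> treats resampling and propagation as one kernel, whereas the
    two tail bounds are applied to successive kernels.\<close>
  moreover have "P N \<bind> resample S N (t + 1) \<bind> propagate S N t
      = P N \<bind> (\<lambda>x. resample S N (t + 1) x \<bind> propagate S N t)" if "0 < N" for N
  proof (rule bind_assoc)
    have "sets (P N) = sets (config_space S N (t + 1))"
      using P[OF that] by (simp add: space_prob_algebra)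
    then show "resample S N (t + 1) \<in> P N \<rightarrow>\<^sub>M subprob_algebra (config_space S N (t + 1))"
      using measurable_prob_algebraD[OF R[OF that]] measurable_cong_sets by blast
    show "propagate S N t \<in> config_space S N (t + 1) \<rightarrow>\<^sub>M subprob_algebra (config_space S N t)"
      by (rule measurable_prob_algebraD[OF measurable_propagate[OF assms(1)]])
  qed
  ultimately show ?thesis
    by (simp cong: converges_completely_cong)
qed

text \<open>The claim for all f is what survives the induction, since the hypothesis is applied to
  \<open>predict t h\<close> for both \<open>weight S t\<close> times f and
  \<open>weight S t\<close> alone in the role of h.\<close>

lemma smc_converges:
  assumes "k \<le> T" "bounded_measurable (path_space S (T - k)) f"
  shows "converges_completely (\<lambda>N. smc S N k) (weighted_mean (T - k) f)
    (path_integral (T - k) f / path_integral (T - k) (\<lambda>_. 1))"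
  using assms
proof (induction k arbitrary: f)
  case 0
  then have f: "bounded_measurable (path_space S T) f"
    by simp
  have Z: "init_mean (weight S T) = path_integral T (\<lambda>_. 1)"
    using path_integral_last[of "\<lambda>_. 1"] by simp
  have "init_mean (\<lambda>x. weight S T x * f x) = path_integral T f"
    using f path_integral_last[of f] by (simp add: bounded_measurable_def)
  then show ?case
    using weighted_mean_converges[OF order.refl f init_in_prob_algebra init_mean_converges]
      path_integral_one_pos[of T] Z by simp
next
  case (Suc k)
  define t where "t = T - Suc k"
  have t: "t < T" "t + 1 = T - k"
    using Suc.prems by (auto simp: t_def)
  have f: "bounded_measurable (path_space S t) f"
    using Suc.prems by (simp add: t_def)
  let ?Z = "path_integral (t + 1) (\<lambda>_. 1)"
  \<comment> \<open>The limit of the unweighted means after propagation. On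
    \<open>weight S t\<close> times g it equals \<open>path_integral t g / ?Z\<close>, so
    \<open>?Z\<close> cancels when the weights are normalized.\<close>
  let ?L = "\<lambda>h. path_integral (t + 1) (predict t h) / ?Z"
  have "0 < ?Z"
    using t by (intro path_integral_one_pos) simp
  have L: "?L (\<lambda>x. weight S t x * g x) = path_integral t g / ?Z" if "bounded_measurable (path_space S t) g" for g
    using path_integral_step[OF t(1) that] by simp
  have L1: "?L (weight S t) = path_integral t (\<lambda>_. 1) / ?Z"
    using L[OF bounded_measurable_const[of _ 1]] by simp
  have "converges_completely (\<lambda>N. smc S N (Suc k)) (weighted_mean t f)
      (?L (\<lambda>x. weight S t x * f x) / ?L (weight S t))"
  proof (rule weighted_mean_converges[where L = ?L, OF _ f])
    show "smc S N (Suc k) \<in> space (prob_algebra (config_space S N t))" if "0 < N" for N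
      using smc_in_prob_algebra[OF Suc.prems(1) that] by (simp only: t_def)
    show "?L (weight S t) \<noteq> 0"
      using \<open>0 < ?Z\<close> path_integral_one_pos[of t] t unfolding L1 by simp
    fix h assume h: "bounded_measurable (path_space S t) h"
    have "converges_completely (\<lambda>N. smc S N k) (weighted_mean (t + 1) (predict t h)) (?L h)"
      using Suc.IH[of "predict t h"] bounded_measurable_predict[OF t(1) h] Suc.prems unfolding t(2) by simp
    then have "converges_completely (\<lambda>N. smc S N k \<bind> (\<lambda>x. resample S N (t + 1) x \<bind> propagate S N t))
        (empirical_mean h) (?L h)"
      using t Suc.prems smc_in_prob_algebra[of k] by (intro empirical_mean_step h) (auto simp: t(2)[symmetric])
    then show "converges_completely (\<lambda>N. smc S N (Suc k)) (empirical_mean h) (?L h)"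
      unfolding smc.simps(2) t(2)[symmetric] t_def[symmetric] .
  qed (use t in simp)
  also have "?L (\<lambda>x. weight S t x * f x) / ?L (weight S t) = path_integral t f / path_integral t (\<lambda>_. 1)"
    unfolding L[OF f] L1 using \<open>0 < ?Z\<close> by simp
  finally show ?case
    by (simp only: t_def)
qed

section \<open>Identification of the limit with the posterior\<close>

text \<open>Each weight divides by the lookahead density left over from the time above and
  contributes its own, while its proposal cancels. Time 0 is excluded because its weight contributes
  no new lookahead factor.\<close>

lemma path_density_telescope:
  assumes "t \<le> T" "0 < t"
  shows "path_density t x = gauss 0 1 (x T) * (\<Prod>s\<in>{t..<T}. transition S s (x (s + 1)) (x s))
    * (\<Prod>s\<in>{t..T}. lik S s (x s)) * pbar S t (x t)"
  using assms
proof (induction rule: inc_induct)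
  case base
  then show ?case
    by (simp add: path_density_last weight_def)
next
  case (step t)
  have "0 < pbar S (t + 1) (x (t + 1))" "0 < proposal S t (x (t + 1)) (x t)"
    using step.hyps by (auto intro: pbar_pos proposal_pos)
  then show ?case
    using step path_density_step[OF step.hyps(2), of x]
    by (simp add: weight_def prod.atLeast_Suc_lessThan[of t T] prod.atLeast_Suc_atMost[of t T])
qed

text \<open>The last weight removes the remaining \<open>pbar S 1\<close>. A positive horizon
  ensures that there is a step from time 1 to time 0.\<close>

lemma path_density_0: "path_density 0 x = joint S x"
proof -
  have "0 < pbar S 1 (x 1)" "0 < proposal S 0 (x 1) (x 0)"
    using horizon_pos by (auto intro: pbar_pos proposal_pos)
  then show ?thesis
    using path_density_step[of 0 x] path_density_telescope[of 1 x] horizon_pos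
    by (simp add: joint_def weight_def atLeast0LessThan[symmetric] atLeast0AtMost[symmetric]
        prod.atLeast_Suc_lessThan[of 0 T] prod.atLeast_Suc_atMost[of 0 T])
qed

lemma posterior_integral:
  "(LINT z:E|path_lebesgue S. posterior S z) = path_integral 0 (indicator E) / path_integral 0 (\<lambda>_. 1)"
  by (simp add: set_lebesgue_integral_def posterior_def path_integral_def path_density_0 path_lebesgue_def)

text \<open>The particle measure of E is the weighted mean of its indicator, a bounded test function
  of the whole path.\<close>

lemma particle_measure_converges:
  assumes "prob_space M" "\<And>N. N > 0 \<Longrightarrow> smc_output S N M (X N)" "E \<in> sets (path_space S 0)"
  shows "AE \<omega> in M. (\<lambda>N. particle_measure S N (X N \<omega>) E) \<longlonglongrightarrow> (LINT z:E|path_lebesgue S. posterior S z)"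
proof -
  have E: "bounded_measurable (path_space S 0) (indicator E)"
    using assms(3) unfolding bounded_measurable_def by (auto intro!: exI[of _ 1] simp: indicator_def)
  have "converges_completely (\<lambda>N. smc S N T) (weighted_mean 0 (indicator E))
      (LINT z:E|path_lebesgue S. posterior S z)"
    using smc_converges[of T "indicator E"] E by (simp add: posterior_integral)
  then have "AE \<omega> in M. (\<lambda>N. weighted_mean 0 (indicator E) N (X N \<omega>))
      \<longlonglongrightarrow> (LINT z:E|path_lebesgue S. posterior S z)"
    using assms(2) E
    by (intro converges_completely_imp_AE[OF assms(1), where A = "\<lambda>N. config_space S N 0"] measurable_weighted_mean)
       (auto simp: smc_output_def bounded_measurable_def)
  then show ?thesis
    by (simp add: particle_measure_def weighted_mean_def)
qed

end

theorem propositionC4: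
  fixes S :: "('z::euclidean_space, 'x::euclidean_space, 'y::euclidean_space) diffusion"
    and M :: "'w measure"
    and X :: "nat \<Rightarrow> 'w \<Rightarrow> nat \<Rightarrow> nat \<Rightarrow> 'z"
  assumes "horizon S > 0"
    and "\<And>t. t \<in> {1..horizon S} \<Longrightarrow> 0 < alpha S t \<and> alpha S t < 1"
    and "eta S > 0" and "sigma1 S > 0" and "tau S > 0"
    and "\<And>t. t \<in> {1..horizon S} \<Longrightarrow> proposal_sd S t > 0"
    and "dec S \<in> borel_measurable borel" and "corr S \<in> borel_measurable borel"
    and "\<And>t. t \<in> {1..horizon S} \<Longrightarrow> (\<lambda>z. eps S z t) \<in> borel_measurable borel"
    and a_lik: "\<And>t. t \<le> horizon S \<Longrightarrow> positive_bounded (lik S t)"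
    and a_ratio: "\<And>t. t < horizon S \<Longrightarrow>
          positive_bounded (\<lambda>(z, z'). pbar S t z / pbar S (t + 1) z')"
    and a_last: "positive_bounded (pbar S (horizon S))"
    and b_cont: "\<And>t. t \<in> {1..horizon S} \<Longrightarrow> continuous_on UNIV (\<lambda>z. ln (pbar S t z))"
    and b_grad: "\<And>t. t \<in> {1..horizon S} \<Longrightarrow> bounded_gradients (\<lambda>z. ln (pbar S t z))"
    and c_cont: "\<And>t. t < horizon S \<Longrightarrow> continuous_on UNIV (\<lambda>m. ln (q_of_mean S t m))"
    and c_grad: "\<And>t. t < horizon S \<Longrightarrow> bounded_gradients (\<lambda>m. ln (q_of_mean S t m))"
    and d: "\<And>t. t \<in> {1..horizon S} \<Longrightarrow> (proposal_sd S t)\<^sup>2 > (prior_sd S t)\<^sup>2"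
    and "prob_space M"
    and "\<And>N. N > 0 \<Longrightarrow> smc_output S N M (X N)"
  shows "\<forall>E \<in> sets (path_space S 0). AE \<omega> in M.
           (\<lambda>N. particle_measure S N (X N \<omega>) E)
             \<longlonglongrightarrow> (LINT z:E|path_lebesgue S. posterior S z)"
proof -
  interpret smc_model S
    using assms(1-12) b_grad c_grad d by unfold_locales
  show ?thesis
    using particle_measure_converges assms by blast
qed

end
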